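(* Let $K,L\in\mathcal{K}_o^n$, $1\leq j\leq n$, $\varphi\in\mathcal{C}$, and $\varepsilon>0$. Then $$1\geq \varphi\left(\left(\frac{\Phi_{n-j}(K)}{\Phi_{n-j}(K+_\varphi\varepsilon\cdot L)}\right)^{1/j}\right)+\varepsilon\,\varphi\left(\left(\frac{\Phi_{n-j}(L)}{\Phi_{n-j}(K+_\varphi\varepsilon\cdot L)}\right)^{1/j}\right).$$ If in addition $\varphi$ is strictly convex, then equality holds if and only if $K$ and $L$ are dilates of each other (i.e. $L=\lambda K$ for some $\lambda>0$).
   Context: $\mathcal{K}_o^n$ is the class of all compact convex subsets of $\mathbb{R}^n$ containing the origin in their interior. $h_K(x)=\sup_{y\in K}\langle x,y\rangle$ is the support function of $K$. $\mathcal{C}$ is the class of all increasing convex functions $\varphi:[0,\infty)\to[0,\infty)$ with $\varphi(0)=0$ and $\varphi(1)=1$. $G_{n,j}$ is the Grassmannian of $j$-dimensional linear subspaces of $\mathbb{R}^n$, $\nu_{n,j}$ its Haar (rotation-invariant) probability measure, $K|\xi$ the orthogonal projection of $K$ onto $\xi\in G_{n,j}$, $\mathrm{vol}_j$ the $j$-dimensional volume, and $\omega_i$ the volume of the Euclidean unit ball of $\mathbb{R}^i$. Orlicz linear combination: for $K,L\in\mathcal{K}_o^n$ and $\varepsilon>0$, $K+_\varphi\varepsilon\cdot L\in\mathcal{K}_o^n$ is the convex body with support function $$h_{K+_\varphi\varepsilon\cdot L}(x)=\inf\left\{\lambda>0:\ \varphi\left(\frac{h_K(x)}{\lambda}\right)+\varepsilon\,\varphi\left(\frac{h_L(x)}{\lambda}\right)\le1\right\}.$$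 Affine quermassintegrals: for $1\le j\le n$, $$\Phi_{n-j}(K)=\frac{\omega_n}{\omega_j}\left(\int_{G_{n,j}}\mathrm{vol}_j(K|\xi)^{-n}\,d\nu_{n,j}(\xi)\right)^{-1/n}$$ (for $j=n$ this is the volume of $K$). *)

theory Defs
  imports "HOL-Probability.Probability"
begin

text \<open>Throughout, the ambient space is \<^typ>\<open>real ^ 'n\<close> and $n$ is \<^term>\<open>CARD('n)\<close>.\<close>

definition convex_bodies_o :: "(real ^ 'n) set set" where
  "convex_bodies_o = {K. compact K \<and> convex K \<and> 0 \<in> interior K}"

definition support_fun :: "(real ^ 'n) set \<Rightarrow> real ^ 'n \<Rightarrow> real" where
  "support_fun K x = (SUP y\<in>K. x \<bullet> y)"

text \<open>Functions on $[0,\infty)$ are represented by functions on the reals, of which only the values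
  on \<^term>\<open>{0::real..}\<close> matter. ``Increasing'' is read in the non-strict sense.\<close>

definition orlicz_class :: "(real \<Rightarrow> real) set" where
  "orlicz_class = {\<phi>. (\<forall>x\<ge>0. \<phi> x \<ge> 0) \<and> mono_on {0..} \<phi> \<and> convex_on {0..} \<phi> \<and> \<phi> 0 = 0 \<and> \<phi> 1 = 1}"

definition strictly_convex_on :: "real set \<Rightarrow> (real \<Rightarrow> real) \<Rightarrow> bool" where
  "strictly_convex_on S f \<longleftrightarrow> convex S \<and>
     (\<forall>x\<in>S. \<forall>y\<in>S. \<forall>t. x \<noteq> y \<longrightarrow> 0 < t \<longrightarrow> t < 1 \<longrightarrow>
        f ((1 - t) * x + t * y) < (1 - t) * f x + t * f y)"

definition orlicz_comb ::
  "(real \<Rightarrow> real) \<Rightarrow> (real ^ 'n) set \<Rightarrow> real \<Rightarrow> (real ^ 'n) set \<Rightarrow> (real ^ 'n) set" where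
  "orlicz_comb \<phi> K \<epsilon> L = (THE M. M \<in> convex_bodies_o \<and>
     (\<forall>x. support_fun M x =
        Inf {l. l > 0 \<and> \<phi> (support_fun K x / l) + \<epsilon> * \<phi> (support_fun L x / l) \<le> 1}))"

definition orth_proj :: "(real ^ 'n) set \<Rightarrow> real ^ 'n \<Rightarrow> real ^ 'n" where
  "orth_proj \<xi> x = (THE y. y \<in> \<xi> \<and> (\<forall>z\<in>\<xi>. orthogonal (x - y) z))"

definition grassmannian :: "nat \<Rightarrow> (real ^ 'n) set set" where
  "grassmannian j = {\<xi>. subspace \<xi> \<and> dim \<xi> = j}"

text \<open>The usual topology of the Grassmannian is the one for which sending a subspace to the matrix
  of the orthogonal projection onto it is an embedding. Its Borel sets are therefore the preimages
  of Borel sets of matrices under this map.\<close>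

definition borel_grassmannian :: "nat \<Rightarrow> (real ^ 'n) set measure" where
  "borel_grassmannian j = vimage_algebra (grassmannian j) (\<lambda>\<xi>. matrix (orth_proj \<xi>)) borel"

text \<open>The Haar probability measure is the unique probability measure on the Borel sets of the
  Grassmannian that is invariant under the action of the rotation group. (The special orthogonal
  and the full orthogonal group give the same measure, as every subspace of positive dimension is
  preserved by some reflection.)\<close>

definition grassmannian_haar :: "nat \<Rightarrow> (real ^ 'n) set measure \<Rightarrow> bool" where
  "grassmannian_haar j \<nu> \<longleftrightarrow> prob_space \<nu> \<and> sets \<nu> = sets (borel_grassmannian j) \<and>
     (\<forall>A. rotation_matrix A \<longrightarrow> distr \<nu> \<nu> (\<lambda>\<xi>. (*v) A ` \<xi>) = \<nu>)"

text \<open>Lebesgue measure on a linear subspace: transport of the product measure along the coordinates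
  of an arbitrary orthonormal basis of the subspace, in the way \<^const>\<open>lborel\<close> is obtained from
  \<^const>\<open>Basis\<close>. The result does not depend on the basis.\<close>

definition orthonormal_basis_of :: "(real ^ 'n) set \<Rightarrow> (real ^ 'n) set \<Rightarrow> bool" where
  "orthonormal_basis_of \<xi> B \<longleftrightarrow> pairwise orthogonal B \<and> (\<forall>b\<in>B. norm b = 1) \<and> span B = \<xi>"

definition subspace_lborel :: "(real ^ 'n) set \<Rightarrow> (real ^ 'n) measure" where
  "subspace_lborel \<xi> =
     (let B = (SOME B. orthonormal_basis_of \<xi> B)
      in distr (\<Pi>\<^sub>M b\<in>B. (lborel :: real measure)) borel (\<lambda>f. \<Sum>b\<in>B. f b *\<^sub>R b))"

definition proj_vol :: "(real ^ 'n) set \<Rightarrow> (real ^ 'n) set \<Rightarrow> real" where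
  "proj_vol K \<xi> = measure (subspace_lborel \<xi>) (orth_proj \<xi> ` K)"

text \<open>With \<^term>\<open>\<nu>\<close> the Haar probability measure on the Grassmannian of $j$-dimensional subspaces,
  \<open>affine_quermassintegral \<nu> j K\<close> is $\Phi_{n-j}(K)$; the index is $j$, not $n-j$.\<close>

definition affine_quermassintegral ::
  "(real ^ 'n) set measure \<Rightarrow> nat \<Rightarrow> (real ^ 'n) set \<Rightarrow> real" where
  "affine_quermassintegral \<nu> j K =
     unit_ball_vol (real CARD('n)) / unit_ball_vol (real j) *
     (\<integral>\<xi>. proj_vol K \<xi> powr (- real CARD('n)) \<partial>\<nu>) powr (- 1 / real CARD('n))"

end

theory Submission
  imports Defs
begin

text \<open>
  Write $\rho(X) = \Phi_{n-j}(X)^{1/j}$ and $M = K +_\varphi \varepsilon \cdot L$, and put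
  $u = \rho(K)/\rho(M)$, $v = \rho(L)/\rho(M)$; the claim is $\varphi(u) + \varepsilon\varphi(v) \le 1$.
  The argument replaces the Orlicz combination by ordinary Minkowski combinations inside it. Convexity
  of $\varphi$ gives slopes $s, t \ge 0$ with
  $$\varphi(x) + \varepsilon\varphi(y) \ge g + (s x + \varepsilon t y - D), \qquad
    g = \varphi(u) + \varepsilon\varphi(v), \quad D = s u + \varepsilon t v,$$
  for all $x, y \ge 0$, and $D \ge g$ because $\varphi(0) = 0$. With $x = h_K/h_M$ and $y = h_L/h_M$ the left side is $1$, so
  $s h_K + \varepsilon t h_L \le (D + 1 - g) h_M$; that is, the Minkowski combination
  $s K + \varepsilon t L$ lies in $(D + 1 - g) M$. The linear inequality
  $\rho(aK + bL) \ge a \rho(K) + b \rho(L)$ turns this into $D \le D + 1 - g$, that is $g \le 1$.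

  If $\varphi$ is strictly convex and $g = 1$, then $s, t > 0$ and the body
  $N = (s K + \varepsilon t L)/D$ lies in $M$ and has the same quermassintegral. The
  quermassintegral is strictly monotone on bodies, so $N = M$, and every point $(h_K/h_M, h_L/h_M)$
  lies on the tangent line as well as on the curve $\varphi(x) + \varepsilon\varphi(y) = 1$.
  Strict convexity leaves only the point $(u, v)$, hence $h_L = (v/u) h_K$. The same tangent lines
  show that the function defining $M$ is indeed a support function (\<open>orlicz_comb_ex\<close>).

  The linear inequality (\<open>quermass_radius_brunn_minkowski\<close>) reduces by homogeneity to bodies
  of equal quermassintegral. There the multiplicative Brunn-Minkowski inequality on each subspace
  (\<open>proj_vol_brunn_minkowski\<close>) and Young's inequality bound the integrand of the combination by
  the corresponding combination of integrands. The multiplicative inequality is the case of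
  indicator functions in the Prekopa-Leindler inequality (\<open>prekopa_leindler_PiM\<close>), which is
  proved on finite products of the real line, that is in the coordinates of an orthonormal basis.

  Strict monotonicity (\<open>quermassintegral_strict_mono\<close>) uses that a rotation-invariant measure
  cannot avoid the subspaces through a given open set (\<open>AE_haar_meets_ball\<close>). The integrals
  themselves have their intended meaning only if the volume of the projection is a measurable function of the
  subspace (\<open>proj_vol_measurable\<close>). This holds because a Gaussian integral over a cylinder,
  which is visibly measurable in the projection matrix, equals that volume up to a constant
  (\<open>gauss_cylinder_proj_vol\<close>).
\<close>

section \<open>The Prekopa-Leindler inequality\<close>

lemma emeasure_lborel_affine_image:
  fixes A :: "real set"
  assumes "A \<in> sets borel" "c \<noteq> 0"
  shows "(\<lambda>x. d + c * x) ` A \<in> sets borel"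
    and "emeasure lborel ((\<lambda>x. d + c * x) ` A) = ennreal \<bar>c\<bar> * emeasure lborel A"
proof -
  have eq: "(\<lambda>x. d + c * x) ` A = (\<lambda>y. (y - d) / c) -` A \<inter> space borel"
  proof (intro set_eqI iffI)
    fix y assume "y \<in> (\<lambda>y. (y - d) / c) -` A \<inter> space borel"
    then have "(y - d) / c \<in> A" "y = d + c * ((y - d) / c)" using assms(2) by auto
    then show "y \<in> (\<lambda>x. d + c * x) ` A" by blast
  qed (use assms(2) in auto)
  show meas: "(\<lambda>x. d + c * x) ` A \<in> sets borel"
    unfolding eq using assms(1) by measurable
  have "emeasure lborel ((\<lambda>x. d + c * x) ` A)
      = (\<integral>\<^sup>+x. indicator ((\<lambda>x. d + c * x) ` A) x \<partial>lborel)"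
    using meas by simp
  also have "\<dots> = ennreal \<bar>c\<bar> * (\<integral>\<^sup>+x. indicator ((\<lambda>x. d + c * x) ` A) (d + c * x) \<partial>lborel)"
    using meas assms(2) by (intro nn_integral_real_affine) auto
  also have "(\<lambda>x. indicator ((\<lambda>x. d + c * x) ` A) (d + c * x) :: ennreal) = indicator A"
    using assms(2) by (auto simp: indicator_def fun_eq_iff)
  finally show "emeasure lborel ((\<lambda>x. d + c * x) ` A) = ennreal \<bar>c\<bar> * emeasure lborel A"
    using assms(1) by simp
qed

text \<open>Translating $A$ by the least point of $B$, and $B$ by the greatest point of $A$, gives two
  subsets of the sumset that share at most one point.\<close>

lemma brunn_minkowski_real_compact:
  fixes A B C :: "real set"
  assumes A: "compact A" "A \<noteq> {}" and B: "compact B" "B \<noteq> {}" and C: "C \<in> sets borel"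
    and sum: "\<And>a b. a \<in> A \<Longrightarrow> b \<in> B \<Longrightarrow> a + b \<in> C"
  shows "emeasure lborel A + emeasure lborel B \<le> emeasure lborel C"
proof -
  obtain p where p: "p \<in> A" "\<And>a. a \<in> A \<Longrightarrow> a \<le> p" using compact_attains_sup[OF A] by blast
  obtain q where q: "q \<in> B" "\<And>b. b \<in> B \<Longrightarrow> q \<le> b" using compact_attains_inf[OF B] by blast
  define A' where "A' = (\<lambda>x. q + 1 * x) ` A"
  define B' where "B' = (\<lambda>x. p + 1 * x) ` B - {p + q}"
  have AB: "A \<in> sets borel" "B \<in> sets borel" using A B by (auto intro: borel_compact)
  have A': "A' \<in> sets borel" "emeasure lborel A' = emeasure lborel A"
    using emeasure_lborel_affine_image[OF AB(1), of 1 q] by (auto simp: A'_def)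
  have Bi: "(\<lambda>x. p + 1 * x) ` B \<in> sets borel"
      "emeasure lborel ((\<lambda>x. p + 1 * x) ` B) = emeasure lborel B"
    using emeasure_lborel_affine_image[OF AB(2), of 1 p] by auto
  have "{p + q} \<in> null_sets lborel" by (simp add: null_sets_def)
  then have B': "B' \<in> sets borel" "emeasure lborel B' = emeasure lborel B"
    unfolding B'_def using Bi emeasure_Diff_null_set[of "{p + q}" lborel "(\<lambda>x. p + 1 * x) ` B"] by auto
  have "A' \<inter> B' = {}"
    using p(2) q(2) by (force simp: A'_def B'_def)
  then have "emeasure lborel A' + emeasure lborel B' = emeasure lborel (A' \<union> B')"
    using A' B' by (intro plus_emeasure) auto
  also have "\<dots> \<le> emeasure lborel C"
    using C sum p(1) q(1) by (intro emeasure_mono) (auto simp: A'_def B'_def add.commute[of q])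
  finally show ?thesis using A' B' by simp
qed

text \<open>Inner regularity, with the approximating set kept nonempty so that sums with it are not lost.\<close>

lemma compact_approx_inside:
  fixes A :: "real set"
  assumes "A \<in> sets borel" "bounded A" "A \<noteq> {}" "0 < e"
  obtains T where "compact T" "T \<noteq> {}" "T \<subseteq> A" "measure lborel A \<le> measure lborel T + e"
proof -
  have "A \<in> sets lebesgue" using assms(1) by auto
  then obtain T where T: "closed T" "T \<subseteq> A" "A - T \<in> lmeasurable" "emeasure lebesgue (A - T) < ennreal e"
    using sets_lebesgue_inner_closed[OF _ assms(4)] by metis
  obtain a where a: "a \<in> A" using assms(3) by auto
  have cT: "compact T" using T assms(2) by (meson bounded_subset compact_eq_bounded_closed)
  then have cT': "compact (insert a T)" by auto
  have fin: "insert a T \<in> fmeasurable lborel"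
    using cT' by (intro fmeasurableI borel_compact emeasure_compact_finite) (auto intro: borel_compact emeasure_compact_finite)
  have fin2: "A - T \<in> fmeasurable lborel"
    using T(1,3) assms(1) by (intro fmeasurableI) (auto simp: fmeasurable_def)
  have "measure lborel A \<le> measure lborel (insert a T \<union> (A - T))"
    using assms(1) fmeasurable.Un[OF fin fin2] by (intro measure_mono_fmeasurable) auto
  also have "\<dots> \<le> measure lborel (insert a T) + measure lborel (A - T)"
    using fin fin2 by (intro measure_Un_le) auto
  also have "measure lborel (A - T) \<le> e"
  proof -
    have "emeasure lborel (A - T) \<le> ennreal e" using T(4) fin2 by (auto simp: fmeasurable_def)
    then show ?thesis using assms(4) fin2
      by (simp add: emeasure_eq_measure2)
  qed
  finally show ?thesis using that[of "insert a T"] cT' T(2) a by auto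
qed

text \<open>The set $C$ stands for a measurable superset of the weighted sumset, since the sumset of two
  Borel sets need not be Borel.\<close>

lemma brunn_minkowski_real:
  fixes A B C :: "real set"
  assumes A: "A \<in> sets borel" "bounded A" "A \<noteq> {}"
    and B: "B \<in> sets borel" "bounded B" "B \<noteq> {}" and C: "C \<in> sets borel"
    and t: "0 < t" "t < 1"
    and sum: "\<And>a b. a \<in> A \<Longrightarrow> b \<in> B \<Longrightarrow> (1 - t) * a + t * b \<in> C"
  shows "ennreal ((1 - t) * measure lborel A + t * measure lborel B) \<le> emeasure lborel C"
proof (rule ennreal_le_epsilon)
  fix e :: real assume e: "0 < e"
  obtain S where S: "compact S" "S \<noteq> {}" "S \<subseteq> A" "measure lborel A \<le> measure lborel S + e"
    using compact_approx_inside[OF A e] by blast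
  obtain T where T: "compact T" "T \<noteq> {}" "T \<subseteq> B" "measure lborel B \<le> measure lborel T + e"
    using compact_approx_inside[OF B e] by blast
  have ST: "S \<in> sets borel" "T \<in> sets borel" using S T by (auto intro: borel_compact)
  have f: "emeasure lborel S = ennreal (measure lborel S)" "emeasure lborel T = ennreal (measure lborel T)"
    using emeasure_compact_finite[OF S(1)] emeasure_compact_finite[OF T(1)]
    by (auto intro!: emeasure_eq_ennreal_measure)
  have "(1 - t) * measure lborel A + t * measure lborel B
      \<le> (1 - t) * (measure lborel S + e) + t * (measure lborel T + e)"
    using S T t by (intro add_mono mult_left_mono) auto
  also have "\<dots> = ((1 - t) * measure lborel S + t * measure lborel T) + e"
    by (simp add: algebra_simps)
  finally have "ennreal ((1 - t) * measure lborel A + t * measure lborel B)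
      \<le> ennreal (((1 - t) * measure lborel S + t * measure lborel T) + e)"
    by (rule ennreal_leI)
  also have "\<dots> = ennreal ((1 - t) * measure lborel S) + ennreal (t * measure lborel T) + ennreal e"
    using t e by simp
  also have "ennreal ((1 - t) * measure lborel S) + ennreal (t * measure lborel T)
      = emeasure lborel ((\<lambda>x. 0 + (1 - t) * x) ` S) + emeasure lborel ((\<lambda>x. 0 + t * x) ` T)"
    using t ST f by (subst (1 2) emeasure_lborel_affine_image) (auto simp: ennreal_mult)
  also have "\<dots> \<le> emeasure lborel C"
  proof (rule brunn_minkowski_real_compact[OF _ _ _ _ C])
    show "compact ((\<lambda>x. 0 + (1 - t) * x) ` S)" "compact ((\<lambda>x. 0 + t * x) ` T)"
      using S T by (auto intro!: compact_continuous_image continuous_intros)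
  qed (use S T sum in auto)
  finally show "ennreal ((1 - t) * measure lborel A + t * measure lborel B) \<le> emeasure lborel C + ennreal e"
    by (simp add: add_right_mono)
qed

text \<open>The layer-cake formula, cut off at height $1$.\<close>

lemma nn_integral_superlevel:
  fixes f :: "real \<Rightarrow> real"
  assumes [measurable]: "f \<in> borel_measurable borel"
  shows "(\<integral>\<^sup>+l. indicator {0..<1} l * emeasure lborel {x. l < f x} \<partial>lborel)
       = (\<integral>\<^sup>+x. ennreal (min 1 (f x)) \<partial>lborel)"
proof -
  have "(\<integral>\<^sup>+l. indicator {0..<1} l * emeasure lborel {x. l < f x} \<partial>lborel)
     = (\<integral>\<^sup>+l. (\<integral>\<^sup>+x. indicator {0..<1} l * indicator {x. l < f x} x \<partial>lborel) \<partial>lborel)"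
    by (intro nn_integral_cong) (simp add: nn_integral_cmult)
  also have "\<dots> = (\<integral>\<^sup>+x. (\<integral>\<^sup>+l. indicator {0..<1} l * indicator {x. l < f x} x \<partial>lborel) \<partial>lborel)"
    by (rule lborel_pair.Fubini') measurable
  also have "\<dots> = (\<integral>\<^sup>+x. ennreal (min 1 (f x)) \<partial>lborel)"
  proof (rule nn_integral_cong)
    fix x
    have "(\<integral>\<^sup>+l. indicator {0..<1} l * indicator {x. l < f x} x \<partial>lborel)
        = (\<integral>\<^sup>+l. indicator {0..<min 1 (f x)} l \<partial>lborel)"
      by (intro nn_integral_cong) (auto simp: indicator_def)
    also have "\<dots> = ennreal (min 1 (f x))"
      by (cases "0 \<le> f x") (auto simp: ennreal_neg)
    finally show "(\<integral>\<^sup>+l. indicator {0..<1} l * indicator {x. l < f x} x \<partial>lborel) = ennreal (min 1 (f x))" .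
  qed
  finally show ?thesis .
qed

text \<open>When both suprema are $1$, the superlevel sets of $f$ and $g$ at every height below $1$ are
  nonempty and their weighted sum lies in the superlevel set of $h$ at the same height; integrate the
  one-dimensional Brunn-Minkowski inequality over the heights.\<close>

lemma prekopa_leindler_real_normalized:
  fixes f g h :: "real \<Rightarrow> real"
  assumes m[measurable]: "f \<in> borel_measurable borel" "g \<in> borel_measurable borel" "h \<in> borel_measurable borel"
    and f1: "\<And>x. 0 \<le> f x \<and> f x \<le> 1" "\<And>l. l < 1 \<Longrightarrow> \<exists>x. l < f x" "\<And>x. f x \<noteq> 0 \<Longrightarrow> \<bar>x\<bar> \<le> R"
    and g1: "\<And>x. 0 \<le> g x \<and> g x \<le> 1" "\<And>l. l < 1 \<Longrightarrow> \<exists>x. l < g x" "\<And>x. g x \<noteq> 0 \<Longrightarrow> \<bar>x\<bar> \<le> R"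
    and h0: "\<And>x. 0 \<le> h x"
    and t: "0 < t" "t < 1"
    and fgh: "\<And>x y. f x powr (1 - t) * g y powr t \<le> h ((1 - t) * x + t * y)"
  shows "ennreal (1 - t) * (\<integral>\<^sup>+x. f x \<partial>lborel) + ennreal t * (\<integral>\<^sup>+x. g x \<partial>lborel) \<le> (\<integral>\<^sup>+x. h x \<partial>lborel)"
proof -
  let ?I = "indicator {0..<1} :: real \<Rightarrow> ennreal"
  \<comment> \<open>Stated for a separate function, because it serves both \<open>f\<close> and \<open>g\<close>.\<close>
  have bd: "bounded {x. l < f x} \<and> emeasure lborel {x. l < f x} = ennreal (measure lborel {x. l < f x})"
    if l: "0 \<le> l" and R: "\<And>x. f x \<noteq> 0 \<Longrightarrow> \<bar>x\<bar> \<le> R" and [measurable]: "f \<in> borel_measurable borel" for l and f :: "real \<Rightarrow> real"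
  proof -
    have b: "bounded {x. l < f x}" using l R by (auto simp: bounded_iff intro!: exI[of _ R])
    from emeasure_bounded_finite[OF b] have "emeasure lborel {x. l < f x} = ennreal (measure lborel {x. l < f x})"
      by (intro emeasure_eq_ennreal_measure) auto
    with b show ?thesis by simp
  qed
  have level: "ennreal (1 - t) * emeasure lborel {x. l < f x} + ennreal t * emeasure lborel {x. l < g x}
      \<le> emeasure lborel {x. l < h x}" if l: "0 \<le> l" "l < 1" for l
  proof -
    have "ennreal ((1 - t) * measure lborel {x. l < f x} + t * measure lborel {x. l < g x})
        \<le> emeasure lborel {x. l < h x}"
    proof (rule brunn_minkowski_real[OF _ _ _ _ _ _ _ t])
      fix a b assume ab: "a \<in> {x. l < f x}" "b \<in> {x. l < g x}"
      have "l = l powr (1 - t) * l powr t" using l by (simp flip: powr_add)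
      also have "\<dots> < f a powr (1 - t) * g b powr t"
        using ab l t by (intro mult_strict_mono') (auto intro: powr_less_mono2)
      also note fgh[of a b]
      finally show "(1 - t) * a + t * b \<in> {x. l < h x}" by simp
    qed (use bd[OF l(1) f1(3)] bd[OF l(1) g1(3)] f1(2)[OF l(2)] g1(2)[OF l(2)] in auto)
    then show ?thesis
      using t bd[OF l(1) f1(3)] bd[OF l(1) g1(3)] by (simp add: ennreal_mult)
  qed
  have "ennreal (1 - t) * (\<integral>\<^sup>+x. f x \<partial>lborel) + ennreal t * (\<integral>\<^sup>+x. g x \<partial>lborel)
      = ennreal (1 - t) * (\<integral>\<^sup>+x. ennreal (min 1 (f x)) \<partial>lborel) + ennreal t * (\<integral>\<^sup>+x. ennreal (min 1 (g x)) \<partial>lborel)"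
    using f1(1) g1(1) by (simp add: min_absorb2)
  also have "\<dots> = ennreal (1 - t) * (\<integral>\<^sup>+l. ?I l * emeasure lborel {x. l < f x} \<partial>lborel)
       + ennreal t * (\<integral>\<^sup>+l. ?I l * emeasure lborel {x. l < g x} \<partial>lborel)"
    by (simp add: nn_integral_superlevel)
  also have "\<dots> = (\<integral>\<^sup>+l. ennreal (1 - t) * (?I l * emeasure lborel {x. l < f x})
       + ennreal t * (?I l * emeasure lborel {x. l < g x}) \<partial>lborel)"
    by (subst nn_integral_add) (auto simp: nn_integral_cmult)
  also have "\<dots> \<le> (\<integral>\<^sup>+l. ?I l * emeasure lborel {x. l < h x} \<partial>lborel)"
    using level by (intro nn_integral_mono) (auto simp: indicator_def)
  also have "\<dots> = (\<integral>\<^sup>+x. ennreal (min 1 (h x)) \<partial>lborel)"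
    by (simp add: nn_integral_superlevel)
  also have "\<dots> \<le> (\<integral>\<^sup>+x. h x \<partial>lborel)"
    by (intro nn_integral_mono) (auto intro: ennreal_leI)
  finally show ?thesis .
qed

text \<open>Dividing $f$ and $g$ by their suprema reduces to the normalized case, whose arithmetic mean of
  integrals dominates the geometric mean by Young's inequality. Bounded functions with bounded support
  keep all integrals finite, so that real powers make sense.\<close>

lemma prekopa_leindler_real:
  fixes f g h :: "real \<Rightarrow> real"
  assumes m[measurable]: "f \<in> borel_measurable borel" "g \<in> borel_measurable borel" "h \<in> borel_measurable borel"
    and f1: "\<And>x. 0 \<le> f x \<and> f x \<le> c" "\<And>x. f x \<noteq> 0 \<Longrightarrow> \<bar>x\<bar> \<le> R"
    and g1: "\<And>x. 0 \<le> g x \<and> g x \<le> c" "\<And>x. g x \<noteq> 0 \<Longrightarrow> \<bar>x\<bar> \<le> R"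
    and h0: "\<And>x. 0 \<le> h x"
    and t: "0 < t" "t < 1"
    and fgh: "\<And>x y. f x powr (1 - t) * g y powr t \<le> h ((1 - t) * x + t * y)"
    and a: "(\<integral>\<^sup>+x. f x \<partial>lborel) = ennreal a" "0 \<le> a" and b: "(\<integral>\<^sup>+x. g x \<partial>lborel) = ennreal b" "0 \<le> b"
  shows "ennreal (a powr (1 - t) * b powr t) \<le> (\<integral>\<^sup>+x. h x \<partial>lborel)"
proof (cases "a = 0 \<or> b = 0")
  case True
  then show ?thesis using t by auto
next
  case False
  then have ab: "0 < a" "0 < b" using a b by auto
  define A where "A = (SUP x. f x)"
  define B where "B = (SUP x. g x)"
  have bdd: "bdd_above (range f)" "bdd_above (range g)" using f1 g1 by (auto intro!: bdd_aboveI2[of _ _ c])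
  have fA: "f x \<le> A" "g x \<le> B" for x
    unfolding A_def B_def using bdd by (auto intro: cSUP_upper)
  have "A > 0"
  proof (rule ccontr)
    assume "\<not> A > 0"
    then have "f = (\<lambda>x. 0)" using fA f1 by (intro ext) (smt (verit))
    then show False using a ab by simp
  qed
  have "B > 0"
  proof (rule ccontr)
    assume "\<not> B > 0"
    then have "g = (\<lambda>x. 0)" using fA g1 by (intro ext) (smt (verit))
    then show False using b ab by simp
  qed
  note AB = \<open>A > 0\<close> \<open>B > 0\<close>
  define m where "m = A powr (1 - t) * B powr t"
  have m: "m > 0" using AB by (simp add: m_def)
  have scale: "(\<integral>\<^sup>+x. ennreal (k x / s) \<partial>lborel) = ennreal (1 / s) * (\<integral>\<^sup>+x. k x \<partial>lborel)"
    if "s > 0" and [measurable]: "k \<in> borel_measurable borel" and "\<And>x. 0 \<le> k x" for s and k :: "real \<Rightarrow> real"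
    using that by (subst nn_integral_cmult[symmetric]) (auto simp flip: ennreal_mult)
  have "ennreal (1 - t) * (\<integral>\<^sup>+x. f x / A \<partial>lborel) + ennreal t * (\<integral>\<^sup>+x. g x / B \<partial>lborel) \<le> (\<integral>\<^sup>+x. h x / m \<partial>lborel)"
  proof (rule prekopa_leindler_real_normalized[where R = R])
    show "\<exists>x. l < f x / A" if "l < 1" for l
    proof -
      have "l * A < A" using that AB by simp
      then obtain x where "l * A < f x" unfolding A_def using less_cSUP_iff[OF _ bdd(1)] by auto
      then show ?thesis using AB by (auto simp: field_simps)
    qed
    show "\<exists>x. l < g x / B" if "l < 1" for l
    proof -
      have "l * B < B" using that AB by simp
      then obtain x where "l * B < g x" unfolding B_def using less_cSUP_iff[OF _ bdd(2)] by auto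
      then show ?thesis using AB by (auto simp: field_simps)
    qed
    show "(f x / A) powr (1 - t) * (g y / B) powr t \<le> h ((1 - t) * x + t * y) / m" for x y
    proof -
      have "(f x / A) powr (1 - t) * (g y / B) powr t = (f x powr (1 - t) * g y powr t) / m"
        using f1 g1 AB by (simp add: powr_divide m_def)
      then show ?thesis using fgh[of x y] m by (simp add: divide_right_mono)
    qed
  qed (use f1 g1 fA AB h0 m t in \<open>auto\<close>)
  then have "ennreal (1 - t) * ennreal (a / A) + ennreal t * ennreal (b / B) \<le> ennreal (1 / m) * (\<integral>\<^sup>+x. h x \<partial>lborel)"
    using AB m f1 g1 h0 a b by (simp add: scale flip: ennreal_mult)
  then have le: "ennreal ((1 - t) * (a / A) + t * (b / B)) \<le> ennreal (1 / m) * (\<integral>\<^sup>+x. h x \<partial>lborel)"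
    using AB a b t by (simp flip: ennreal_mult ennreal_plus)
  have "a powr (1 - t) * b powr t = m * ((a / A) powr (1 - t) * (b / B) powr t)"
    using ab AB by (simp add: powr_divide m_def)
  also have "\<dots> \<le> m * ((1 - t) * (a / A) + t * (b / B))"
    using ab AB t m by (intro mult_left_mono Youngs_inequality_0) auto
  finally have "ennreal (a powr (1 - t) * b powr t) \<le> ennreal (m * ((1 - t) * (a / A) + t * (b / B)))"
    by (rule ennreal_leI)
  also have "\<dots> = ennreal m * ennreal ((1 - t) * (a / A) + t * (b / B))"
    using m ab AB t by (intro ennreal_mult) auto
  also have "\<dots> \<le> ennreal m * (ennreal (1 / m) * (\<integral>\<^sup>+x. h x \<partial>lborel))"
    by (intro mult_left_mono le) auto
  also have "\<dots> = (\<integral>\<^sup>+x. h x \<partial>lborel)"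
    using m by (simp flip: mult.assoc ennreal_mult)
  finally show ?thesis .
qed

text \<open>Induction on the number of coordinates. The points of the product space are the extensional
  functions on $I$; a pointwise convex combination of two of them takes the default
  value outside $I$ again, hence is extensional as well.\<close>

lemma prekopa_leindler_PiM:
  fixes f g h :: "('i \<Rightarrow> real) \<Rightarrow> real"
  assumes "finite I" and R: "0 \<le> R" and t: "0 < t" "t < 1"
    and "f \<in> borel_measurable (PiM I (\<lambda>_. lborel))"
    and "g \<in> borel_measurable (PiM I (\<lambda>_. lborel))"
    and "h \<in> borel_measurable (PiM I (\<lambda>_. lborel))"
    and "\<And>x. 0 \<le> f x \<and> f x \<le> c" "\<And>x i. f x \<noteq> 0 \<Longrightarrow> i \<in> I \<Longrightarrow> \<bar>x i\<bar> \<le> R"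
    and "\<And>x. 0 \<le> g x \<and> g x \<le> c" "\<And>x i. g x \<noteq> 0 \<Longrightarrow> i \<in> I \<Longrightarrow> \<bar>x i\<bar> \<le> R"
    and "\<And>x. 0 \<le> h x \<and> h x \<le> c" "\<And>x i. h x \<noteq> 0 \<Longrightarrow> i \<in> I \<Longrightarrow> \<bar>x i\<bar> \<le> R"
    and "\<And>x y. x \<in> space (PiM I (\<lambda>_. lborel)) \<Longrightarrow> y \<in> space (PiM I (\<lambda>_. lborel)) \<Longrightarrow>
           f x powr (1 - t) * g y powr t \<le> h (\<lambda>i. (1 - t) * x i + t * y i)"
  shows "ennreal (enn2real (\<integral>\<^sup>+x. f x \<partial>PiM I (\<lambda>_. lborel)) powr (1 - t) *
                  enn2real (\<integral>\<^sup>+x. g x \<partial>PiM I (\<lambda>_. lborel)) powr t)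
         \<le> (\<integral>\<^sup>+x. h x \<partial>PiM I (\<lambda>_. lborel))"
  using assms(1,5-)
proof (induction I arbitrary: f g h c rule: finite_induct)
  case empty
  interpret product_sigma_finite "\<lambda>_::'i. lborel :: real measure" by standard
  let ?u = "\<lambda>_::'i. undefined :: real"
  have "(\<lambda>i. (1 - t) * ?u i + t * ?u i) = ?u" by (simp add: algebra_simps)
  then have "f ?u powr (1 - t) * g ?u powr t \<le> h ?u"
    using empty.prems(10)[of ?u ?u] by (simp add: space_PiM)
  then show ?case using empty.prems by (simp add: nn_integral_empty ennreal_leI)
next
  case (insert i I)
  interpret product_sigma_finite "\<lambda>_::'i. lborel :: real measure" by standard
  let ?P = "\<lambda>I::'i set. PiM I (\<lambda>_. lborel :: real measure)"
  \<comment> \<open>Integrate out the coordinate \<open>i\<close>; the hypotheses survive, by the one-dimensional case.\<close>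
  define S where "S k x = enn2real (\<integral>\<^sup>+z. ennreal (k (x(i := z))) \<partial>lborel)" for k :: "('i \<Rightarrow> real) \<Rightarrow> real" and x
  define bdd_supp where "bdd_supp k \<longleftrightarrow> (\<forall>x. 0 \<le> k x \<and> k x \<le> c) \<and> (\<forall>x. k x \<noteq> 0 \<longrightarrow> (\<forall>j\<in>insert i I. \<bar>x j\<bar> \<le> R))"
    for k :: "('i \<Rightarrow> real) \<Rightarrow> real"
  have bound: "(\<integral>\<^sup>+z. ennreal (k (x(i := z))) \<partial>lborel) \<le> ennreal (c * (2 * R))"
    if "bdd_supp k" for k x
  proof -
    have c: "0 \<le> c" using that unfolding bdd_supp_def by (meson order_trans)
    have "(\<integral>\<^sup>+z. ennreal (k (x(i := z))) \<partial>lborel) \<le> (\<integral>\<^sup>+z. ennreal c * indicator {-R..R} z \<partial>lborel)"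
    proof (intro nn_integral_mono)
      fix z
      show "ennreal (k (x(i := z))) \<le> ennreal c * indicator {-R..R} z"
        using that[unfolded bdd_supp_def, THEN conjunct1, rule_format, of "x(i := z)"]
          that[unfolded bdd_supp_def, THEN conjunct2, rule_format, of "x(i := z)" i]
        by (cases "k (x(i := z)) = 0") (auto simp: indicator_def ennreal_leI abs_le_iff)
    qed
    also have "\<dots> = ennreal c * ennreal (2 * R)" using R by (simp add: nn_integral_cmult)
    finally show ?thesis using c R by (simp add: ennreal_mult)
  qed
  have S: "ennreal (S k x) = (\<integral>\<^sup>+z. ennreal (k (x(i := z))) \<partial>lborel)" "0 \<le> S k x" "S k x \<le> c * (2 * R)"
    if "bdd_supp k" for k x
  proof -
    have c: "0 \<le> c" using that unfolding bdd_supp_def by (meson order_trans)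
    note b = bound[OF that, of x]
    show "ennreal (S k x) = (\<integral>\<^sup>+z. ennreal (k (x(i := z))) \<partial>lborel)"
      unfolding S_def using b by (intro ennreal_enn2real) (metis ennreal_less_top le_less_trans)
    show "0 \<le> S k x" by (simp add: S_def)
    show "S k x \<le> c * (2 * R)" unfolding S_def using enn2real_mono[OF b] c R by simp
  qed
  have supp: "\<bar>x j\<bar> \<le> R" if "bdd_supp k" "S k x \<noteq> 0" "j \<in> I" for k x j
  proof -
    have "\<exists>z. k (x(i := z)) \<noteq> 0"
    proof (rule ccontr)
      assume "\<not> (\<exists>z. k (x(i := z)) \<noteq> 0)"
      then show False using that(2) by (simp add: S_def)
    qed
    then obtain z where "k (x(i := z)) \<noteq> 0" by blast
    with that(1) have "\<bar>(x(i := z)) j\<bar> \<le> R" unfolding bdd_supp_def using that(3) by blast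
    then show ?thesis using that(3) insert.hyps(2) by (cases "j = i") auto
  qed
  have meas: "S k \<in> borel_measurable (?P I)" if [measurable]: "k \<in> borel_measurable (?P (insert i I))" for k
    unfolding S_def by measurable
  have slice: "(\<lambda>z. k (x(i := z))) \<in> borel_measurable borel"
    if [measurable]: "k \<in> borel_measurable (?P (insert i I))" and "x \<in> space (?P I)" for k and x :: "'i \<Rightarrow> real"
    using measurable_comp[OF measurable_component_update[OF that(2) insert.hyps(2)] that(1)]
    by (simp add: comp_def)
  have int: "(\<integral>\<^sup>+x. ennreal (k x) \<partial>?P (insert i I)) = (\<integral>\<^sup>+x. ennreal (S k x) \<partial>?P I)"
    if "bdd_supp k" "k \<in> borel_measurable (?P (insert i I))" for k
    using product_nn_integral_insert[OF insert.hyps, of "\<lambda>x. ennreal (k x)"] that(2) by (simp add: S(1)[OF that(1)])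
  note p = insert.prems
  have ok: "bdd_supp f" "bdd_supp g" "bdd_supp h"
    unfolding bdd_supp_def using p(4-9) by blast+
  show ?case
    unfolding int[OF ok(1) p(1)] int[OF ok(2) p(2)] int[OF ok(3) p(3)]
  proof (rule insert.IH)
    show "S f \<in> borel_measurable (?P I)" "S g \<in> borel_measurable (?P I)" "S h \<in> borel_measurable (?P I)"
      using p meas by auto
    show "0 \<le> S f x \<and> S f x \<le> c * (2 * R)" "0 \<le> S g x \<and> S g x \<le> c * (2 * R)" "0 \<le> S h x \<and> S h x \<le> c * (2 * R)" for x
      using S(2,3)[OF ok(1)] S(2,3)[OF ok(2)] S(2,3)[OF ok(3)] by auto
    show "\<bar>x j\<bar> \<le> R" if "S f x \<noteq> 0" "j \<in> I" for x j by (rule supp[OF ok(1) that])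
    show "\<bar>x j\<bar> \<le> R" if "S g x \<noteq> 0" "j \<in> I" for x j by (rule supp[OF ok(2) that])
    show "\<bar>x j\<bar> \<le> R" if "S h x \<noteq> 0" "j \<in> I" for x j by (rule supp[OF ok(3) that])
    fix x y assume x: "x \<in> space (?P I)" and y: "y \<in> space (?P I)"
    let ?w = "\<lambda>j. (1 - t) * x j + t * y j"
    have w: "?w \<in> space (?P I)" using x y by (auto simp: space_PiM PiE_def extensional_def algebra_simps)
    have upd: "z(i := a) \<in> space (?P (insert i I))" if "z \<in> space (?P I)" for z a
      using that by (auto simp: space_PiM PiE_def extensional_def)
    have "ennreal (S f x powr (1 - t) * S g y powr t) \<le> (\<integral>\<^sup>+z. h (?w(i := z)) \<partial>lborel)"
    proof (rule prekopa_leindler_real[where R = R and c = c])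
      show "f (x(i := a)) powr (1 - t) * g (y(i := b)) powr t \<le> h (?w(i := (1 - t) * a + t * b))" for a b
      proof -
        have eq: "?w(i := (1 - t) * a + t * b) = (\<lambda>j. (1 - t) * (x(i := a)) j + t * (y(i := b)) j)"
          by auto
        show ?thesis unfolding eq by (rule p(10)[OF upd[OF x] upd[OF y]])
      qed
      show "\<bar>z\<bar> \<le> R" if "f (x(i := z)) \<noteq> 0" for z using p(5)[OF that, of i] by simp
      show "\<bar>z\<bar> \<le> R" if "g (y(i := z)) \<noteq> 0" for z using p(7)[OF that, of i] by simp
    qed (use p S[OF ok(1)] S[OF ok(2)] slice[OF _ x] slice[OF _ y] slice[OF _ w] t in auto)
    also have "\<dots> = ennreal (S h ?w)" using S(1)[OF ok(3)] by simp
    finally show "S f x powr (1 - t) * S g y powr t \<le> S h ?w"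
      using S(2)[OF ok(3)] by (simp add: ennreal_le_iff)
  qed
qed

text \<open>The Prekopa-Leindler inequality for indicator functions.\<close>

lemma brunn_minkowski_PiM:
  fixes A B C :: "('i \<Rightarrow> real) set"
  assumes "finite I" and t: "0 < t" "t < 1"
    and m: "A \<in> sets (PiM I (\<lambda>_. lborel))" "B \<in> sets (PiM I (\<lambda>_. lborel))" "C \<in> sets (PiM I (\<lambda>_. lborel))"
    and R: "0 \<le> R" "\<And>x i. x \<in> A \<union> B \<union> C \<Longrightarrow> i \<in> I \<Longrightarrow> \<bar>x i\<bar> \<le> R"
    and C: "\<And>x y. x \<in> A \<Longrightarrow> y \<in> B \<Longrightarrow> (\<lambda>i. (1 - t) * x i + t * y i) \<in> C"
  shows "measure (PiM I (\<lambda>_. lborel)) A powr (1 - t) * measure (PiM I (\<lambda>_. lborel)) B powr t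
       \<le> measure (PiM I (\<lambda>_. lborel)) C"
proof -
  interpret product_sigma_finite "\<lambda>_::'i. lborel :: real measure" by standard
  let ?P = "PiM I (\<lambda>_. lborel :: real measure)"
  have "ennreal (enn2real (\<integral>\<^sup>+x. ennreal (indicator A x) \<partial>?P) powr (1 - t) *
                  enn2real (\<integral>\<^sup>+x. ennreal (indicator B x) \<partial>?P) powr t)
         \<le> (\<integral>\<^sup>+x. ennreal (indicator C x) \<partial>?P)"
  proof (rule prekopa_leindler_PiM[where R = R and c = 1])
    show "indicator A x powr (1 - t) * indicator B y powr t \<le> (indicator C (\<lambda>i. (1 - t) * x i + t * y i) :: real)" for x y
      using C[of x y] t by (auto simp: indicator_def)
  qed (use assms in \<open>auto simp: indicator_def split: if_splits intro: R(2)\<close>)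
  then have le: "ennreal (measure ?P A powr (1 - t) * measure ?P B powr t) \<le> emeasure ?P C"
    using m by (simp add: ennreal_indicator measure_def)
  have "C \<subseteq> (\<Pi>\<^sub>E i\<in>I. {-R..R})"
  proof
    fix x assume x: "x \<in> C"
    then have "x \<in> space ?P" using sets.sets_into_space[OF m(3)] by blast
    moreover have "x i \<in> {-R..R}" if "i \<in> I" for i using R(2)[of x i] x that by (simp add: abs_le_iff)
    ultimately show "x \<in> (\<Pi>\<^sub>E i\<in>I. {-R..R})" by (simp add: space_PiM PiE_iff)
  qed
  then have "emeasure ?P C \<le> emeasure ?P (\<Pi>\<^sub>E i\<in>I. {-R..R})"
    using assms(1) by (intro emeasure_mono) (auto intro!: sets_PiM_I_finite)
  also have "\<dots> = (\<Prod>i\<in>I. emeasure lborel {-R..R})"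
    using assms(1) by (intro emeasure_PiM) auto
  also have "\<dots> < \<infinity>" using R(1) by (simp add: ennreal_power)
  finally have "emeasure ?P C = ennreal (measure ?P C)" by (intro emeasure_eq_ennreal_measure) auto
  with le show ?thesis by (simp add: ennreal_le_iff)
qed

text \<open>Both the homogeneity of volume (no shift) and its translation invariance (\<open>c = 1\<close>) come
  from this one substitution rule.\<close>

lemma nn_integral_PiM_affine:
  fixes F :: "('i \<Rightarrow> real) \<Rightarrow> ennreal"
  assumes "finite I" "0 < c" "F \<in> borel_measurable (PiM I (\<lambda>_. lborel))"
  shows "(\<integral>\<^sup>+x. F (\<lambda>i\<in>I. d i + x i / c) \<partial>PiM I (\<lambda>_. lborel))
       = ennreal (c ^ card I) * (\<integral>\<^sup>+x. F x \<partial>PiM I (\<lambda>_. lborel))"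
  using assms(1,3)
proof (induction I arbitrary: F rule: finite_induct)
  case empty
  interpret product_sigma_finite "\<lambda>_::'i. lborel :: real measure" by standard
  show ?case by (subst (1 2) nn_integral_empty) (auto simp: restrict_def)
next
  case (insert i I)
  interpret product_sigma_finite "\<lambda>_::'i. lborel :: real measure" by standard
  let ?P = "\<lambda>I::'i set. PiM I (\<lambda>_. lborel :: real measure)"
  note [measurable] = insert.prems
  define Q where "Q x = (\<integral>\<^sup>+y. F (x(i := y)) \<partial>lborel)" for x
  have [measurable]: "Q \<in> borel_measurable (?P I)" unfolding Q_def by measurable
  have "(\<integral>\<^sup>+x. F (\<lambda>j\<in>insert i I. d j + x j / c) \<partial>?P (insert i I))
      = (\<integral>\<^sup>+x. (\<integral>\<^sup>+y. F (\<lambda>j\<in>insert i I. d j + (x(i := y)) j / c) \<partial>lborel) \<partial>?P I)"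
    by (rule product_nn_integral_insert) (use insert.hyps in measurable)
  also have "\<dots> = (\<integral>\<^sup>+x. ennreal c * Q (\<lambda>j\<in>I. d j + x j / c) \<partial>?P I)"
  proof (rule nn_integral_cong)
    fix x assume x: "x \<in> space (?P I)"
    let ?x = "\<lambda>j\<in>I. d j + x j / c"
    have x': "?x \<in> space (?P I)" by (simp add: space_PiM)
    have "(\<lambda>j\<in>insert i I. d j + (x(i := y)) j / c) = ?x(i := d i + y / c)" for y
      using insert.hyps by auto
    moreover have "(\<lambda>y. F (?x(i := y))) \<in> borel_measurable borel"
      using measurable_comp[OF measurable_component_update[OF x' insert.hyps(2)] insert.prems]
      by (simp add: comp_def)
    note [measurable] = this
    have "(\<integral>\<^sup>+y. F (?x(i := d i + y / c)) \<partial>lborel) = ennreal \<bar>c\<bar> * (\<integral>\<^sup>+y. F (?x(i := d i + ((- c * d i) + c * y) / c)) \<partial>lborel)"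
      by (rule nn_integral_real_affine) (use assms(2) in auto)
    ultimately show "(\<integral>\<^sup>+y. F (\<lambda>j\<in>insert i I. d j + (x(i := y)) j / c) \<partial>lborel) = ennreal c * Q ?x"
      using assms(2) by (simp add: Q_def add_divide_distrib diff_divide_distrib)
  qed
  also have "\<dots> = ennreal c * (ennreal (c ^ card I) * (\<integral>\<^sup>+x. Q x \<partial>?P I))"
    by (simp add: nn_integral_cmult insert.IH)
  also have "(\<integral>\<^sup>+x. Q x \<partial>?P I) = (\<integral>\<^sup>+x. F x \<partial>?P (insert i I))"
    unfolding Q_def using insert.hyps by (simp add: product_nn_integral_insert)
  finally show ?case using insert.hyps assms(2) by (simp add: ennreal_mult mult.assoc)
qed

section \<open>Volumes of projections in orthonormal coordinates\<close>

lemma orthonormal_basis_ofD: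
  fixes B :: "(real ^ 'n) set"
  assumes "orthonormal_basis_of \<xi> B"
  shows "finite B" "card B = dim \<xi>" "subspace \<xi>" "B \<subseteq> \<xi>"
    and "\<And>a b. a \<in> B \<Longrightarrow> b \<in> B \<Longrightarrow> a \<bullet> b = (if a = b then 1 else 0)"
proof -
  have o: "pairwise orthogonal B" "\<And>b. b \<in> B \<Longrightarrow> norm b = 1" "span B = \<xi>"
    using assms by (auto simp: orthonormal_basis_of_def)
  then have i: "independent B" by (intro pairwise_orthogonal_independent) (metis norm_zero zero_neq_one)+
  then show "finite B" by (rule independent_imp_finite)
  show "card B = dim \<xi>" using i o(3) dim_span_eq_card_independent by metis
  show "subspace \<xi>" "B \<subseteq> \<xi>" using o(3) by (auto simp: span_base)
  show "a \<bullet> b = (if a = b then 1 else 0)" if "a \<in> B" "b \<in> B" for a b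
    using that o by (auto simp: pairwise_def orthogonal_def dot_square_norm)
qed

lemma orthonormal_basis_of_exists:
  fixes \<xi> :: "(real ^ 'n) set"
  assumes "subspace \<xi>"
  obtains B where "orthonormal_basis_of \<xi> B"
  using orthonormal_basis_subspace[OF assms] unfolding orthonormal_basis_of_def by metis

definition lin_comb :: "(real ^ 'n) set \<Rightarrow> (real ^ 'n \<Rightarrow> real) \<Rightarrow> real ^ 'n" where
  "lin_comb B f = (\<Sum>b\<in>B. f b *\<^sub>R b)"

lemma lin_comb_measurable[measurable]:
  "lin_comb B \<in> borel_measurable (PiM B (\<lambda>_. lborel))"
  unfolding lin_comb_def by measurable

context
  fixes \<xi> B :: "(real ^ 'n) set"
  assumes B: "orthonormal_basis_of \<xi> B"
begin

lemma lin_comb_in: "lin_comb B f \<in> \<xi>"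
  unfolding lin_comb_def using orthonormal_basis_ofD[OF B]
  by (intro subspace_sum subspace_scale) auto

lemma inner_lin_comb: "b \<in> B \<Longrightarrow> lin_comb B f \<bullet> b = f b"
  unfolding lin_comb_def inner_sum_left using orthonormal_basis_ofD[OF B]
  by (simp add: if_distrib[of "(*) _"] cong: if_cong)

lemma norm_lin_comb: "(norm (lin_comb B f))\<^sup>2 = (\<Sum>b\<in>B. (f b)\<^sup>2)"
proof -
  have "(norm (lin_comb B f))\<^sup>2 = lin_comb B f \<bullet> (\<Sum>b\<in>B. f b *\<^sub>R b)"
    by (simp add: dot_square_norm lin_comb_def)
  then show ?thesis by (simp add: inner_sum_right inner_lin_comb power2_eq_square)
qed

lemma lin_comb_inner:
  assumes "x \<in> \<xi>" shows "lin_comb B (\<lambda>b. x \<bullet> b) = x"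
proof -
  have "x \<in> span B" using assms B by (simp add: orthonormal_basis_of_def)
  then obtain c where "x = lin_comb B c"
    using orthonormal_basis_ofD(1)[OF B] by (auto simp: span_finite lin_comb_def)
  then show ?thesis by (auto simp: lin_comb_def[of _ "\<lambda>b. _ \<bullet> b"] inner_lin_comb) (simp add: lin_comb_def)
qed

lemma orth_proj_eq: "orth_proj \<xi> x = lin_comb B (\<lambda>b. x \<bullet> b)"
  unfolding orth_proj_def
proof (rule the_equality)
  have "orthogonal (x - lin_comb B (\<lambda>b. x \<bullet> b)) z" if "z \<in> span B" for z
  proof (rule orthogonal_to_span[OF that])
    show "orthogonal (x - lin_comb B (\<lambda>b. x \<bullet> b)) b" if "b \<in> B" for b
      using that by (simp add: orthogonal_def inner_diff_left inner_lin_comb)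
  qed
  then show "lin_comb B (\<lambda>b. x \<bullet> b) \<in> \<xi> \<and> (\<forall>z\<in>\<xi>. orthogonal (x - lin_comb B (\<lambda>b. x \<bullet> b)) z)"
    using lin_comb_in B by (auto simp: orthonormal_basis_of_def)
  fix y assume y: "y \<in> \<xi> \<and> (\<forall>z\<in>\<xi>. orthogonal (x - y) z)"
  have "x \<bullet> b = y \<bullet> b" if "b \<in> B" for b
    using y orthonormal_basis_ofD(4)[OF B] that by (auto simp: orthogonal_def inner_diff_left)
  then have "lin_comb B (\<lambda>b. x \<bullet> b) = lin_comb B (\<lambda>b. y \<bullet> b)" by (simp add: lin_comb_def)
  then show "y = lin_comb B (\<lambda>b. x \<bullet> b)" using lin_comb_inner y by simp
qed

end

lemma linear_orth_proj:
  fixes \<xi> :: "(real ^ 'n) set"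
  assumes "subspace \<xi>" shows "linear (orth_proj \<xi>)"
proof -
  obtain B where B: "orthonormal_basis_of \<xi> B" using orthonormal_basis_of_exists[OF assms] .
  show ?thesis
    unfolding orth_proj_eq[OF B, abs_def] lin_comb_def
    by (intro linearI) (simp_all add: inner_add_left scaleR_add_left sum.distrib scaleR_sum_right)
qed

lemma
  fixes \<xi> :: "(real ^ 'n) set"
  assumes "subspace \<xi>"
  shows orth_proj_in: "orth_proj \<xi> x \<in> \<xi>"
    and orth_proj_ident: "x \<in> \<xi> \<Longrightarrow> orth_proj \<xi> x = x"
    and inner_orth_proj: "x \<in> \<xi> \<Longrightarrow> x \<bullet> orth_proj \<xi> y = x \<bullet> y"
    and norm_orth_proj_le: "norm (orth_proj \<xi> x) \<le> norm x"
    and orthogonal_orth_proj: "z \<in> \<xi> \<Longrightarrow> orthogonal (x - orth_proj \<xi> x) z"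
proof -
  obtain B where B: "orthonormal_basis_of \<xi> B" using orthonormal_basis_of_exists[OF assms] .
  show in': "orth_proj \<xi> x \<in> \<xi>" for x using lin_comb_in[OF B] by (simp add: orth_proj_eq[OF B])
  show "orth_proj \<xi> x = x" if "x \<in> \<xi>" using lin_comb_inner[OF B that] by (simp add: orth_proj_eq[OF B])
  show inner: "x \<bullet> orth_proj \<xi> y = x \<bullet> y" if "x \<in> \<xi>" for x y
  proof -
    have "x \<bullet> orth_proj \<xi> y = lin_comb B (\<lambda>b. x \<bullet> b) \<bullet> y"
      by (simp add: orth_proj_eq[OF B] lin_comb_def inner_sum_right inner_sum_left inner_commute mult.commute)
    then show ?thesis using lin_comb_inner[OF B that] by simp
  qed
  show "orthogonal (x - orth_proj \<xi> x) z" if "z \<in> \<xi>"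
    using inner[OF that, of x] by (simp add: orthogonal_def inner_diff_right inner_commute[of _ z])
  have "(norm (orth_proj \<xi> x))\<^sup>2 = orth_proj \<xi> x \<bullet> x"
    using inner[OF in', of x x] by (simp add: power2_norm_eq_inner)
  also have "\<dots> \<le> norm (orth_proj \<xi> x) * norm x" by (rule norm_cauchy_schwarz)
  finally show "norm (orth_proj \<xi> x) \<le> norm x"
    by (cases "norm (orth_proj \<xi> x) = 0") (auto simp: power2_eq_square mult_le_cancel_left)
qed

lemma compact_orth_proj:
  fixes \<xi> :: "(real ^ 'n) set"
  assumes "subspace \<xi>" "compact K" shows "compact (orth_proj \<xi> ` K)"
  using assms by (intro compact_continuous_image linear_continuous_on) (auto simp: linear_orth_proj linear_linear)

lemma convex_orth_proj:
  fixes \<xi> :: "(real ^ 'n) set"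
  assumes "subspace \<xi>" "convex K" shows "convex (orth_proj \<xi> ` K)"
  using assms by (intro convex_linear_image linear_orth_proj)

text \<open>The part of $S$ in the span of $B$, described by coordinates with respect to $B$; for an orthonormal
  basis its product measure is the volume.\<close>

definition coord_preimage :: "(real ^ 'n) set \<Rightarrow> (real ^ 'n) set \<Rightarrow> (real ^ 'n \<Rightarrow> real) set" where
  "coord_preimage B S = lin_comb B -` S \<inter> space (PiM B (\<lambda>_. lborel))"

lemma sets_coord_preimage: "S \<in> sets borel \<Longrightarrow> coord_preimage B S \<in> sets (PiM B (\<lambda>_. lborel))"
  unfolding coord_preimage_def using lin_comb_measurable measurable_sets by blast

lemma proj_vol_coords:
  fixes \<xi> :: "(real ^ 'n) set"
  assumes "subspace \<xi>"
  obtains B where "orthonormal_basis_of \<xi> B"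
    and "\<And>K. compact K \<Longrightarrow> proj_vol K \<xi> = measure (PiM B (\<lambda>_. lborel)) (coord_preimage B (orth_proj \<xi> ` K))"
proof -
  define B where "B = (SOME B. orthonormal_basis_of \<xi> B)"
  have B: "orthonormal_basis_of \<xi> B"
    unfolding B_def using orthonormal_basis_of_exists[OF assms] by (metis someI_ex)
  have eq: "subspace_lborel \<xi> = distr (PiM B (\<lambda>_. lborel)) borel (lin_comb B)"
    unfolding subspace_lborel_def B_def[symmetric] Let_def lin_comb_def ..
  have "proj_vol K \<xi> = measure (PiM B (\<lambda>_. lborel)) (coord_preimage B (orth_proj \<xi> ` K))" if "compact K" for K
    unfolding proj_vol_def eq coord_preimage_def
    using compact_orth_proj[OF assms that] by (intro measure_distr borel_compact) measurable
  with B that show ?thesis by blast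
qed

text \<open>Coordinates with respect to an orthonormal basis are bounded by the norm, so the set lies in
  a cube of side $2R$.\<close>

lemma coord_preimage_cball:
  fixes B :: "(real ^ 'n) set"
  assumes B: "orthonormal_basis_of \<xi> B" and S: "S \<subseteq> cball 0 R" "0 \<le> R"
  shows "x \<in> coord_preimage B S \<Longrightarrow> b \<in> B \<Longrightarrow> \<bar>x b\<bar> \<le> R"
    and "emeasure (PiM B (\<lambda>_. lborel)) (coord_preimage B S) \<le> ennreal ((2 * R) ^ card B)"
proof -
  interpret product_sigma_finite "\<lambda>_::real ^ 'n. lborel :: real measure" by standard
  note fin = orthonormal_basis_ofD(1)[OF B]
  show bd: "\<bar>x b\<bar> \<le> R" if "x \<in> coord_preimage B S" "b \<in> B" for x b
  proof -
    have "\<bar>x b\<bar> = \<bar>lin_comb B x \<bullet> b\<bar>" using inner_lin_comb[OF B that(2)] by simp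
    also have "\<dots> \<le> norm (lin_comb B x) * norm b" by (rule Cauchy_Schwarz_ineq2)
    also have "norm b = 1" using B that by (auto simp: orthonormal_basis_of_def)
    also have "norm (lin_comb B x) * 1 \<le> R" using that S by (auto simp: coord_preimage_def)
    finally show ?thesis .
  qed
  have "emeasure (PiM B (\<lambda>_. lborel)) (coord_preimage B S) \<le> emeasure (PiM B (\<lambda>_. lborel)) (\<Pi>\<^sub>E b\<in>B. {-R..R})"
  proof (rule emeasure_mono)
    show "coord_preimage B S \<subseteq> (\<Pi>\<^sub>E b\<in>B. {-R..R})"
    proof
      fix x assume x: "x \<in> coord_preimage B S"
      then have "x \<in> space (PiM B (\<lambda>_. lborel :: real measure))" by (simp add: coord_preimage_def)
      moreover have "x b \<in> {-R..R}" if "b \<in> B" for b using bd[OF x that] by (simp add: abs_le_iff)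
      ultimately show "x \<in> (\<Pi>\<^sub>E b\<in>B. {-R..R})" by (simp add: space_PiM PiE_iff)
    qed
  qed (auto intro!: sets_PiM_I_finite fin)
  also have "\<dots> = ennreal ((2 * R) ^ card B)"
    using S(2) by (subst emeasure_PiM) (auto simp: fin ennreal_power)
  finally show "emeasure (PiM B (\<lambda>_. lborel)) (coord_preimage B S) \<le> ennreal ((2 * R) ^ card B)" .
qed

text \<open>A cube around $q$ of half-side $r/(\mathrm{card}\,B + 1)$ fits into the ball, by the triangle inequality.
  The resulting lower bound depends only on the dimension and $r$, not on the subspace.\<close>

lemma coord_preimage_ball:
  fixes B :: "(real ^ 'n) set"
  assumes B: "orthonormal_basis_of \<xi> B" and S: "S \<in> sets borel"
    and q: "q \<in> \<xi>" "0 < r" "ball q r \<inter> \<xi> \<subseteq> S"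
  shows "ennreal ((2 * r / (card B + 1)) ^ card B) \<le> emeasure (PiM B (\<lambda>_. lborel)) (coord_preimage B S)"
proof -
  interpret product_sigma_finite "\<lambda>_::real ^ 'n. lborel :: real measure" by standard
  note fin = orthonormal_basis_ofD(1)[OF B]
  define \<delta> where "\<delta> = r / (card B + 1)"
  have \<delta>: "0 < \<delta>" "card B * \<delta> < r" using q by (auto simp: \<delta>_def field_simps)
  have "ennreal ((2 * r / (card B + 1)) ^ card B) = emeasure (PiM B (\<lambda>_. lborel)) (\<Pi>\<^sub>E b\<in>B. {q \<bullet> b - \<delta>..q \<bullet> b + \<delta>})"
    using \<delta> by (subst emeasure_PiM) (auto simp: fin ennreal_power \<delta>_def)
  also have "\<dots> \<le> emeasure (PiM B (\<lambda>_. lborel)) (coord_preimage B S)"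
  proof (intro emeasure_mono subsetI)
    fix x assume x: "x \<in> (\<Pi>\<^sub>E b\<in>B. {q \<bullet> b - \<delta>..q \<bullet> b + \<delta>})"
    have "lin_comb B x - q = lin_comb B x - lin_comb B (\<lambda>b. q \<bullet> b)" using lin_comb_inner[OF B q(1)] by simp
    also have "\<dots> = (\<Sum>b\<in>B. (x b - q \<bullet> b) *\<^sub>R b)" by (simp add: lin_comb_def scaleR_diff_left sum_subtractf)
    also have "norm \<dots> \<le> (\<Sum>b\<in>B. \<delta>)"
    proof (rule sum_norm_le)
      fix b assume b: "b \<in> B"
      have "x b \<in> {q \<bullet> b - \<delta>..q \<bullet> b + \<delta>}" using x b by (auto simp: PiE_iff)
      moreover have "norm b = 1" using B b by (auto simp: orthonormal_basis_of_def)
      ultimately show "norm ((x b - q \<bullet> b) *\<^sub>R b) \<le> \<delta>" by (auto simp: abs_le_iff)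
    qed
    also have "\<dots> < r" using \<delta> by simp
    finally have "lin_comb B x \<in> ball q r" by (simp add: dist_norm norm_minus_commute)
    then have "lin_comb B x \<in> S" using q lin_comb_in[OF B] by blast
    then show "x \<in> coord_preimage B S" using x by (auto simp: coord_preimage_def space_PiM PiE_iff)
  qed (rule sets_coord_preimage[OF S])
  finally show ?thesis .
qed

lemma emeasure_coord_preimage_finite:
  fixes B :: "(real ^ 'n) set"
  assumes B: "orthonormal_basis_of \<xi> B" and S: "bounded S"
  shows "emeasure (PiM B (\<lambda>_. lborel)) (coord_preimage B S)
       = ennreal (measure (PiM B (\<lambda>_. lborel)) (coord_preimage B S))"
proof -
  obtain R where "S \<subseteq> cball 0 R" "R \<ge> 0"
    using S bounded_pos[of S] by (auto simp: subset_iff intro: less_imp_le)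
  from coord_preimage_cball(2)[OF B this] show ?thesis
    by (intro emeasure_eq_ennreal_measure) (auto simp: top_unique)
qed

lemma compact_subset_cball:
  fixes K :: "(real ^ 'n) set"
  assumes "compact K" obtains R where "K \<subseteq> cball 0 R" "0 < R"
  using compact_imp_bounded[OF assms] bounded_pos[of K] by (auto simp: subset_iff)

lemma proj_vol_mono:
  fixes \<xi> K L :: "(real ^ 'n) set"
  assumes \<xi>: "subspace \<xi>" and K: "compact K" and L: "compact L" and sub: "K \<subseteq> L"
  shows "proj_vol K \<xi> \<le> proj_vol L \<xi>"
proof -
  obtain B where B: "orthonormal_basis_of \<xi> B"
    and v: "\<And>K. compact K \<Longrightarrow> proj_vol K \<xi> = measure (PiM B (\<lambda>_. lborel)) (coord_preimage B (orth_proj \<xi> ` K))"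
    using proj_vol_coords[OF \<xi>] by blast
  have "emeasure (PiM B (\<lambda>_. lborel)) (coord_preimage B (orth_proj \<xi> ` K)) \<le> emeasure (PiM B (\<lambda>_. lborel)) (coord_preimage B (orth_proj \<xi> ` L))"
    using sub compact_orth_proj[OF \<xi> L]
    by (intro emeasure_mono sets_coord_preimage borel_compact) (auto simp: coord_preimage_def)
  then show ?thesis
    using emeasure_coord_preimage_finite[OF B compact_imp_bounded[OF compact_orth_proj[OF \<xi> K]]]
      emeasure_coord_preimage_finite[OF B compact_imp_bounded[OF compact_orth_proj[OF \<xi> L]]]
    by (simp add: v K L ennreal_le_iff)
qed

text \<open>Uniform bounds in the subspace are what makes negative powers of the projection volume
  integrable over the Grassmannian.\<close>

lemma proj_vol_bounds:
  fixes K :: "(real ^ 'n) set"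
  assumes "K \<in> convex_bodies_o"
  obtains lo hi where "0 < lo" "\<And>\<xi>. \<xi> \<in> grassmannian j \<Longrightarrow> lo \<le> proj_vol K \<xi> \<and> proj_vol K \<xi> \<le> hi"
proof -
  from assms have K: "compact K" "0 \<in> interior K" by (auto simp: convex_bodies_o_def)
  obtain R where R: "K \<subseteq> cball 0 R" "0 < R" using compact_subset_cball[OF K(1)] .
  obtain r where r: "0 < r" "ball 0 r \<subseteq> K" using K(2) by (auto simp: mem_interior)
  have "(2 * r / (j + 1)) ^ j \<le> proj_vol K \<xi> \<and> proj_vol K \<xi> \<le> (2 * R) ^ j" if "\<xi> \<in> grassmannian j" for \<xi>
  proof -
    have \<xi>: "subspace \<xi>" "dim \<xi> = j" using that by (auto simp: grassmannian_def)
    obtain B where B: "orthonormal_basis_of \<xi> B"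
      and v: "\<And>K. compact K \<Longrightarrow> proj_vol K \<xi> = measure (PiM B (\<lambda>_. lborel)) (coord_preimage B (orth_proj \<xi> ` K))"
      using proj_vol_coords[OF \<xi>(1)] by blast
    have card: "card B = j" using orthonormal_basis_ofD(2)[OF B] \<xi> by simp
    note cP = compact_orth_proj[OF \<xi>(1) K(1)]
    have e: "emeasure (PiM B (\<lambda>_. lborel)) (coord_preimage B (orth_proj \<xi> ` K)) = ennreal (proj_vol K \<xi>)"
      using emeasure_coord_preimage_finite[OF B compact_imp_bounded[OF cP]] v[OF K(1)] by simp
    have "ball 0 r \<inter> \<xi> \<subseteq> orth_proj \<xi> ` K"
      using r orth_proj_ident[OF \<xi>(1)] by (force simp: image_iff)
    from coord_preimage_ball[OF B borel_compact[OF cP] subspace_0[OF \<xi>(1)] r(1) this]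
    have "(2 * r / (j + 1)) ^ j \<le> proj_vol K \<xi>"
      by (simp add: e card ennreal_le_iff proj_vol_def)
    moreover have "orth_proj \<xi> ` K \<subseteq> cball 0 R"
    proof
      fix y assume "y \<in> orth_proj \<xi> ` K"
      then obtain x where "x \<in> K" "y = orth_proj \<xi> x" by blast
      then show "y \<in> cball 0 R" using R norm_orth_proj_le[OF \<xi>(1), of x] by (auto simp: subset_iff)
    qed
    from coord_preimage_cball(2)[OF B this] have "proj_vol K \<xi> \<le> (2 * R) ^ j"
      using R by (simp add: e card ennreal_le_iff)
    ultimately show ?thesis ..
  qed
  moreover have "0 < (2 * r / (j + 1)) ^ j" using r by simp
  ultimately show ?thesis using that by blast
qed

lemma dilate_mem_iff:
  fixes y :: "real ^ 'n"
  assumes "0 < c" shows "y \<in> (\<lambda>x. c *\<^sub>R x) ` K \<longleftrightarrow> (1 / c) *\<^sub>R y \<in> K"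
proof
  assume "(1 / c) *\<^sub>R y \<in> K"
  moreover have "y = c *\<^sub>R ((1 / c) *\<^sub>R y)" using assms by simp
  ultimately show "y \<in> (\<lambda>x. c *\<^sub>R x) ` K" by blast
qed (use assms in auto)

lemma proj_vol_scale:
  fixes \<xi> K :: "(real ^ 'n) set"
  assumes \<xi>: "subspace \<xi>" and K: "compact K" and c: "0 < c"
  shows "proj_vol ((\<lambda>x. c *\<^sub>R x) ` K) \<xi> = c ^ dim \<xi> * proj_vol K \<xi>"
proof -
  obtain B where B: "orthonormal_basis_of \<xi> B"
    and v: "\<And>K. compact K \<Longrightarrow> proj_vol K \<xi> = measure (PiM B (\<lambda>_. lborel)) (coord_preimage B (orth_proj \<xi> ` K))"
    using proj_vol_coords[OF \<xi>] by blast
  let ?P = "PiM B (\<lambda>_. lborel :: real measure)"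
  let ?S = "coord_preimage B (orth_proj \<xi> ` K)"
  have cK: "compact ((\<lambda>x. c *\<^sub>R x) ` K)" using K by (rule compact_scaling)
  have S: "?S \<in> sets ?P" "coord_preimage B (orth_proj \<xi> ` (\<lambda>x. c *\<^sub>R x) ` K) \<in> sets ?P"
    using compact_orth_proj[OF \<xi>] K cK by (auto intro!: sets_coord_preimage borel_compact)
  have ind: "indicator (coord_preimage B (orth_proj \<xi> ` (\<lambda>x. c *\<^sub>R x) ` K)) x
      = (indicator ?S (\<lambda>b\<in>B. 0 + x b / c) :: ennreal)" if x: "x \<in> space ?P" for x
  proof -
    have "lin_comb B (\<lambda>b\<in>B. 0 + x b / c) = (1 / c) *\<^sub>R lin_comb B x"
      by (simp add: lin_comb_def scaleR_sum_right)
    moreover have "orth_proj \<xi> ` (\<lambda>x. c *\<^sub>R x) ` K = (\<lambda>x. c *\<^sub>R x) ` orth_proj \<xi> ` K"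
      using linear_scale[OF linear_orth_proj[OF \<xi>]] by (simp add: image_image)
    ultimately show ?thesis using x by (simp add: coord_preimage_def indicator_def space_PiM dilate_mem_iff[OF c])
  qed
  have "emeasure ?P (coord_preimage B (orth_proj \<xi> ` (\<lambda>x. c *\<^sub>R x) ` K))
      = (\<integral>\<^sup>+x. indicator ?S (\<lambda>b\<in>B. 0 + x b / c) \<partial>?P)"
    using S(2) by (subst nn_integral_indicator[symmetric]) (simp_all only: ind cong: nn_integral_cong)
  also have "\<dots> = ennreal (c ^ card B) * (\<integral>\<^sup>+x. indicator ?S x \<partial>?P)"
    by (rule nn_integral_PiM_affine) (use orthonormal_basis_ofD(1)[OF B] c S in auto)
  also have "\<dots> = ennreal (c ^ card B) * emeasure ?P ?S" using S by simp
  finally have "measure ?P (coord_preimage B (orth_proj \<xi> ` (\<lambda>x. c *\<^sub>R x) ` K)) = c ^ card B * measure ?P ?S"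
    using c by (simp add: measure_def enn2real_mult)
  then show ?thesis using v[OF K] v[OF cK] orthonormal_basis_ofD(2)[OF B] by simp
qed

lemma proj_vol_brunn_minkowski:
  fixes \<xi> K L N :: "(real ^ 'n) set"
  assumes \<xi>: "subspace \<xi>" and K: "compact K" and L: "compact L" and N: "compact N" and t: "0 < t" "t < 1"
    and sum: "\<And>x y. x \<in> K \<Longrightarrow> y \<in> L \<Longrightarrow> (1 - t) *\<^sub>R x + t *\<^sub>R y \<in> N"
  shows "proj_vol K \<xi> powr (1 - t) * proj_vol L \<xi> powr t \<le> proj_vol N \<xi>"
proof -
  obtain B where B: "orthonormal_basis_of \<xi> B"
    and v: "\<And>K. compact K \<Longrightarrow> proj_vol K \<xi> = measure (PiM B (\<lambda>_. lborel)) (coord_preimage B (orth_proj \<xi> ` K))"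
    using proj_vol_coords[OF \<xi>] by blast
  note c = compact_orth_proj[OF \<xi>]
  have "compact (orth_proj \<xi> ` K \<union> orth_proj \<xi> ` L \<union> orth_proj \<xi> ` N)" using c K L N by auto
  then obtain R where R: "orth_proj \<xi> ` K \<union> orth_proj \<xi> ` L \<union> orth_proj \<xi> ` N \<subseteq> cball 0 R" "0 < R"
    by (rule compact_subset_cball)
  show ?thesis
    unfolding v[OF K] v[OF L] v[OF N]
  proof (rule brunn_minkowski_PiM[where R = R])
    show "\<bar>x i\<bar> \<le> R"
      if "x \<in> coord_preimage B (orth_proj \<xi> ` K) \<union> coord_preimage B (orth_proj \<xi> ` L) \<union> coord_preimage B (orth_proj \<xi> ` N)" "i \<in> B" for x i
      using that R by (intro coord_preimage_cball(1)[OF B R(1)]) (auto simp: coord_preimage_def)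
    fix x y assume x: "x \<in> coord_preimage B (orth_proj \<xi> ` K)" and y: "y \<in> coord_preimage B (orth_proj \<xi> ` L)"
    let ?w = "\<lambda>i. (1 - t) * x i + t * y i"
    obtain k l where kl: "k \<in> K" "l \<in> L" "lin_comb B x = orth_proj \<xi> k" "lin_comb B y = orth_proj \<xi> l"
      using x y by (auto simp: coord_preimage_def)
    have "lin_comb B ?w = (1 - t) *\<^sub>R lin_comb B x + t *\<^sub>R lin_comb B y"
      by (simp add: lin_comb_def scaleR_add_left sum.distrib scaleR_sum_right)
    also have "\<dots> = orth_proj \<xi> ((1 - t) *\<^sub>R k + t *\<^sub>R l)"
      using linear_orth_proj[OF \<xi>] kl by (simp add: linear_add linear_scale)
    finally have "lin_comb B ?w \<in> orth_proj \<xi> ` N" using sum kl by blast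
    moreover have "?w \<in> space (PiM B (\<lambda>_. lborel))"
      using x y by (auto simp: coord_preimage_def space_PiM PiE_def extensional_def algebra_simps)
    ultimately show "?w \<in> coord_preimage B (orth_proj \<xi> ` N)" by (simp add: coord_preimage_def)
  qed (use orthonormal_basis_ofD(1)[OF B] t R c K L N in \<open>auto intro!: sets_coord_preimage borel_compact\<close>)
qed

section \<open>Measurability of the projection volume\<close>

definition gauss :: "real \<Rightarrow> ennreal" where "gauss x = ennreal (exp (- x\<^sup>2 / 2))"

definition gauss_mass :: ennreal where "gauss_mass = (\<integral>\<^sup>+x. gauss x \<partial>lborel)"

lemma gauss_measurable[measurable]: "gauss \<in> borel_measurable borel"
  unfolding gauss_def by measurable

lemma gauss_mass_pos_finite: "gauss_mass \<noteq> 0" "gauss_mass \<noteq> top"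
proof -
  have "1 = emeasure (density lborel (\<lambda>x. ennreal (std_normal_density x))) UNIV"
    using prob_space.emeasure_space_1[OF prob_space_normal_density[of 1 0]] by simp
  also have "\<dots> = (\<integral>\<^sup>+x. ennreal (std_normal_density x) \<partial>lborel)"
    by (subst emeasure_density) auto
  also have "\<dots> = (\<integral>\<^sup>+x. ennreal (1 / sqrt (2 * pi)) * gauss x \<partial>lborel)"
    by (simp add: std_normal_density_def gauss_def flip: ennreal_mult)
  also have "\<dots> = ennreal (1 / sqrt (2 * pi)) * gauss_mass"
    unfolding gauss_mass_def by (intro nn_integral_cmult) measurable
  finally have e: "ennreal (1 / sqrt (2 * pi)) * gauss_mass = 1" by simp
  show "gauss_mass \<noteq> 0" using e by auto
  show "gauss_mass \<noteq> top" using e by (auto simp: ennreal_mult_top)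
qed

text \<open>The Gaussian weight is at once a function of the norm and a product over coordinates; the
  independence of Lebesgue measure from the orthonormal basis rests on this.\<close>

lemma gauss_lin_comb:
  fixes B :: "(real ^ 'n) set"
  assumes "orthonormal_basis_of \<xi> B"
  shows "gauss (norm (lin_comb B f)) = (\<Prod>b\<in>B. gauss (f b))"
  unfolding gauss_def norm_lin_comb[OF assms]
  using orthonormal_basis_ofD(1)[OF assms]
  by (simp add: prod_ennreal sum_divide_distrib flip: exp_sum sum_negf)

lemma nn_integral_gauss_lin_comb:
  fixes B :: "(real ^ 'n) set"
  assumes "orthonormal_basis_of \<xi> B"
  shows "(\<integral>\<^sup>+f. gauss (norm (lin_comb B f)) \<partial>PiM B (\<lambda>_. lborel)) = gauss_mass ^ card B"
proof -
  interpret product_sigma_finite "\<lambda>_::real ^ 'n. lborel :: real measure" by standard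
  show ?thesis
    unfolding gauss_lin_comb[OF assms] using orthonormal_basis_ofD(1)[OF assms]
    by (subst product_nn_integral_prod) (auto simp: gauss_mass_def)
qed

lemma orthonormal_basis_Basis: "orthonormal_basis_of UNIV (Basis :: (real ^ 'n) set)"
  unfolding orthonormal_basis_of_def
  by (auto simp: pairwise_def orthogonal_def inner_not_same_Basis)

lemma nn_integral_lborel_Basis:
  fixes F :: "real ^ 'n \<Rightarrow> ennreal"
  assumes "F \<in> borel_measurable borel"
  shows "(\<integral>\<^sup>+x. F x \<partial>lborel) = (\<integral>\<^sup>+f. F (lin_comb Basis f) \<partial>PiM Basis (\<lambda>_. lborel))"
  using assms by (subst lborel_eq) (simp add: nn_integral_distr lin_comb_def)

lemma nn_integral_PiM_translate:
  fixes F :: "('i \<Rightarrow> real) \<Rightarrow> ennreal"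
  assumes "finite I" "F \<in> borel_measurable (PiM I (\<lambda>_. lborel))"
  shows "(\<integral>\<^sup>+x. F (\<lambda>i\<in>I. d i + x i) \<partial>PiM I (\<lambda>_. lborel)) = (\<integral>\<^sup>+x. F x \<partial>PiM I (\<lambda>_. lborel))"
  using nn_integral_PiM_affine[OF assms(1) _ assms(2), of 1 d] by simp

text \<open>Both sides are translation-invariant integrals on the whole space. By Tonelli two such integrals
  are proportional: their products with each other's value at a fixed test function agree after the
  substitutions $y \mapsto y + Tf$ and $Tf \mapsto Tf - y$. The Gaussian as test function shows that the factor is $1$.\<close>

lemma nn_integral_lborel_orthonormal:
  fixes C :: "(real ^ 'n) set" and F :: "real ^ 'n \<Rightarrow> ennreal"
  assumes C: "orthonormal_basis_of UNIV C" and F[measurable]: "F \<in> borel_measurable borel"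
  shows "(\<integral>\<^sup>+x. F x \<partial>lborel) = (\<integral>\<^sup>+f. F (lin_comb C f) \<partial>PiM C (\<lambda>_. lborel))"
proof -
  interpret product_sigma_finite "\<lambda>_::real ^ 'n. lborel :: real measure" by standard
  note fin = orthonormal_basis_ofD(1)[OF C]
  let ?P = "PiM C (\<lambda>_. lborel :: real measure)"
  let ?T = "lin_comb C"
  interpret P: sigma_finite_measure ?P using fin by (rule sigma_finite)
  interpret L: sigma_finite_measure "lborel :: (real ^ 'n) measure" by (rule sigma_finite_lborel)
  interpret PL: pair_sigma_finite ?P "lborel :: (real ^ 'n) measure" by standard
  let ?g = "\<lambda>x :: real ^ 'n. gauss (norm x)"
  have transl: "(\<integral>\<^sup>+x. G (a + x) \<partial>lborel) = (\<integral>\<^sup>+x. G x \<partial>lborel)"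
    if [measurable]: "G \<in> borel_measurable borel" for G :: "real ^ 'n \<Rightarrow> ennreal" and a
    using nn_integral_distr[of "(+) a" lborel borel G] by (simp add: lborel_distr_plus)
  have refl: "(\<integral>\<^sup>+y. G (- y) \<partial>lborel) = (\<integral>\<^sup>+y. G y \<partial>lborel)"
    if [measurable]: "G \<in> borel_measurable borel" for G :: "real ^ 'n \<Rightarrow> ennreal"
  proof -
    have "(lborel :: (real ^ 'n) measure) = distr lborel borel uminus"
      using lborel_affine[of "-1" "0 :: real ^ 'n"] by (simp add: density_1)
    then have "(\<integral>\<^sup>+y. G y \<partial>lborel) = (\<integral>\<^sup>+y. G y \<partial>distr lborel borel uminus)" by simp
    also have "\<dots> = (\<integral>\<^sup>+y. G (- y) \<partial>lborel)" by (intro nn_integral_distr) auto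
    finally show ?thesis by simp
  qed
  have "(\<integral>\<^sup>+f. F (?T f) \<partial>?P) * (\<integral>\<^sup>+y. ?g y \<partial>lborel) = (\<integral>\<^sup>+f. (\<integral>\<^sup>+y. F (?T f) * ?g y \<partial>lborel) \<partial>?P)"
    by (simp add: nn_integral_cmult nn_integral_multc)
  also have "\<dots> = (\<integral>\<^sup>+f. (\<integral>\<^sup>+y. F (?T f) * ?g (?T f + y) \<partial>lborel) \<partial>?P)"
    by (intro nn_integral_cong transl[symmetric]) measurable
  also have "\<dots> = (\<integral>\<^sup>+y. (\<integral>\<^sup>+f. F (?T f) * ?g (?T f + y) \<partial>?P) \<partial>lborel)"
    by (rule PL.Fubini'[symmetric]) measurable
  also have "\<dots> = (\<integral>\<^sup>+y. (\<integral>\<^sup>+f. F (?T f - y) * ?g (?T f) \<partial>?P) \<partial>lborel)"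
  proof (rule nn_integral_cong)
    fix y :: "real ^ 'n"
    have eq: "?T (\<lambda>b\<in>C. - (y \<bullet> b) + f b) = ?T f - y" for f
    proof -
      have "?T (\<lambda>b\<in>C. - (y \<bullet> b) + f b) = ?T f - ?T (\<lambda>b. y \<bullet> b)"
        by (simp add: lin_comb_def scaleR_diff_left sum_subtractf)
      then show ?thesis using lin_comb_inner[OF C] by simp
    qed
    show "(\<integral>\<^sup>+f. F (?T f) * ?g (?T f + y) \<partial>?P) = (\<integral>\<^sup>+f. F (?T f - y) * ?g (?T f) \<partial>?P)"
      using nn_integral_PiM_translate[OF fin, of "\<lambda>f. F (?T f) * ?g (?T f + y)" "\<lambda>b. - (y \<bullet> b)", unfolded eq]
      by simp
  qed
  also have "\<dots> = (\<integral>\<^sup>+f. (\<integral>\<^sup>+y. F (?T f - y) * ?g (?T f) \<partial>lborel) \<partial>?P)"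
    by (rule PL.Fubini') measurable
  also have "\<dots> = (\<integral>\<^sup>+f. (\<integral>\<^sup>+y. F y \<partial>lborel) * ?g (?T f) \<partial>?P)"
  proof (rule nn_integral_cong)
    fix f
    have "(\<integral>\<^sup>+y. F (?T f - y) \<partial>lborel) = (\<integral>\<^sup>+y. F (?T f + y) \<partial>lborel)"
      using refl[of "\<lambda>y. F (?T f + y)"] by simp
    also have "\<dots> = (\<integral>\<^sup>+y. F y \<partial>lborel)" by (rule transl) measurable
    finally show "(\<integral>\<^sup>+y. F (?T f - y) * ?g (?T f) \<partial>lborel) = (\<integral>\<^sup>+y. F y \<partial>lborel) * ?g (?T f)"
      by (simp add: nn_integral_multc)
  qed
  also have "\<dots> = (\<integral>\<^sup>+y. F y \<partial>lborel) * gauss_mass ^ card C"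
    using nn_integral_gauss_lin_comb[OF C] by (simp add: nn_integral_cmult)
  finally have "(\<integral>\<^sup>+f. F (?T f) \<partial>?P) * (\<integral>\<^sup>+y. ?g y \<partial>lborel) = (\<integral>\<^sup>+y. F y \<partial>lborel) * gauss_mass ^ card C" .
  moreover have "(\<integral>\<^sup>+y. ?g y \<partial>lborel) = gauss_mass ^ card C"
  proof -
    have "card C = card (Basis :: (real ^ 'n) set)"
      using orthonormal_basis_ofD(2)[OF C] orthonormal_basis_ofD(2)[OF orthonormal_basis_Basis] by simp
    then show ?thesis
      using nn_integral_gauss_lin_comb[OF orthonormal_basis_Basis, where 'n = 'n] by (simp add: nn_integral_lborel_Basis)
  qed
  ultimately have e: "gauss_mass ^ card C * (\<integral>\<^sup>+f. F (?T f) \<partial>?P) = gauss_mass ^ card C * (\<integral>\<^sup>+y. F y \<partial>lborel)"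
    by (simp add: mult.commute)
  have "gauss_mass ^ card C \<noteq> 0" "gauss_mass ^ card C \<noteq> top"
    using gauss_mass_pos_finite by (auto simp: power_eq_top_ennreal)
  then show ?thesis using e by (metis ennreal_mult_cancel_left)
qed

text \<open>In an orthonormal basis adapted to $\xi$ and its orthogonal complement, the integral
  splits into the volume of the projection and a Gaussian integral over the complement, whose value depends only on
  its dimension.\<close>

lemma gauss_cylinder_proj_vol:
  fixes \<xi> K :: "(real ^ 'n) set"
  assumes \<xi>: "\<xi> \<in> grassmannian j" and K: "compact K"
  shows "(\<integral>\<^sup>+x. indicator (orth_proj \<xi> ` K) (orth_proj \<xi> x) * gauss (norm (x - orth_proj \<xi> x)) \<partial>lborel)
       = ennreal (proj_vol K \<xi>) * gauss_mass ^ (CARD('n) - j)"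
proof -
  interpret product_sigma_finite "\<lambda>_::real ^ 'n. lborel :: real measure" by standard
  have s: "subspace \<xi>" "dim \<xi> = j" using \<xi> by (auto simp: grassmannian_def)
  obtain B where B: "orthonormal_basis_of \<xi> B"
    and v: "\<And>K. compact K \<Longrightarrow> proj_vol K \<xi> = measure (PiM B (\<lambda>_. lborel)) (coord_preimage B (orth_proj \<xi> ` K))"
    using proj_vol_coords[OF s(1)] by blast
  define \<eta> where "\<eta> = {x. \<forall>z\<in>\<xi>. orthogonal z x}"
  have "subspace \<eta>" unfolding \<eta>_def by (rule subspace_orthogonal_to_vectors)
  then obtain D where D: "orthonormal_basis_of \<eta> D" using orthonormal_basis_of_exists by blast
  note finB = orthonormal_basis_ofD[OF B] note finD = orthonormal_basis_ofD[OF D]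
  have orth: "x \<bullet> y = 0" if "x \<in> \<xi>" "y \<in> \<eta>" for x y using that by (auto simp: \<eta>_def orthogonal_def)
  have disj: "B \<inter> D = {}"
  proof -
    have "False" if "b \<in> B" "b \<in> D" for b
      using orth[of b b] that finB(4,5) finD(4) by force
    then show ?thesis by blast
  qed
  have C: "orthonormal_basis_of UNIV (B \<union> D)"
    unfolding orthonormal_basis_of_def
  proof (intro conjI ballI)
    show "pairwise orthogonal (B \<union> D)"
      using B D orth finB(4) finD(4)
      unfolding orthonormal_basis_of_def pairwise_def orthogonal_def by (metis Un_iff inner_commute subsetD)
    show "norm b = 1" if "b \<in> B \<union> D" for b using that B D by (auto simp: orthonormal_basis_of_def)
    have "x \<in> span (B \<union> D)" for x
    proof -
      have "x - orth_proj \<xi> x \<in> \<eta>"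
        using orthogonal_orth_proj[OF s(1)] by (auto simp: \<eta>_def orthogonal_commute)
      then have "x - orth_proj \<xi> x \<in> span (B \<union> D)" "orth_proj \<xi> x \<in> span (B \<union> D)"
        using orth_proj_in[OF s(1), of x] B D span_mono[of B "B \<union> D"] span_mono[of D "B \<union> D"]
        by (auto simp: orthonormal_basis_of_def)
      then show ?thesis using span_add[of "x - orth_proj \<xi> x" _ "orth_proj \<xi> x"] by simp
    qed
    then show "span (B \<union> D) = UNIV" by auto
  qed
  have card: "card D = CARD('n) - j"
    using orthonormal_basis_ofD(2)[OF C] finB(1,2) finD(1) disj s(2) by (simp add: card_Un_disjoint)
  have lin: "linear (orth_proj \<xi>)" by (rule linear_orth_proj[OF s(1)])
  have [measurable]: "orth_proj \<xi> \<in> borel_measurable borel"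
    using lin by (intro borel_measurable_continuous_onI linear_continuous_on) (simp add: linear_linear)
  have [measurable]: "orth_proj \<xi> ` K \<in> sets borel" by (intro borel_compact compact_orth_proj s K)
  let ?F = "\<lambda>x. indicator (orth_proj \<xi> ` K) (orth_proj \<xi> x) * gauss (norm (x - orth_proj \<xi> x))"
  have merge: "?F (lin_comb (B \<union> D) (merge B D (x, y)))
      = indicator (orth_proj \<xi> ` K) (lin_comb B x) * gauss (norm (lin_comb D y))" for x y
  proof -
    have "lin_comb (B \<union> D) (merge B D (x, y)) = lin_comb B x + lin_comb D y"
      unfolding lin_comb_def using finB(1) finD(1) disj
      by (subst sum.union_disjoint) (auto intro!: arg_cong2[where f = "(+)"] sum.cong simp: merge_def)
    moreover have "orth_proj \<xi> (lin_comb D y) = 0"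
      using orth[OF _ lin_comb_in[OF D]] finB(4)
      by (subst orth_proj_eq[OF B]) (auto simp: lin_comb_def[of B] inner_commute intro!: sum.neutral)
    ultimately show ?thesis
      using orth_proj_ident[OF s(1) lin_comb_in[OF B]] lin by (simp add: linear_add)
  qed
  have "(\<integral>\<^sup>+x. ?F x \<partial>lborel) = (\<integral>\<^sup>+f. ?F (lin_comb (B \<union> D) f) \<partial>PiM (B \<union> D) (\<lambda>_. lborel))"
    by (rule nn_integral_lborel_orthonormal[OF C]) measurable
  also have "\<dots> = (\<integral>\<^sup>+x. (\<integral>\<^sup>+y. ?F (lin_comb (B \<union> D) (merge B D (x, y))) \<partial>PiM D (\<lambda>_. lborel)) \<partial>PiM B (\<lambda>_. lborel))"
    by (rule product_nn_integral_fold[OF disj finB(1) finD(1)]) measurable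
  also have "\<dots> = (\<integral>\<^sup>+x. indicator (orth_proj \<xi> ` K) (lin_comb B x) * gauss_mass ^ card D \<partial>PiM B (\<lambda>_. lborel))"
    unfolding merge using nn_integral_gauss_lin_comb[OF D] by (simp add: nn_integral_cmult)
  also have "\<dots> = (\<integral>\<^sup>+x. indicator (orth_proj \<xi> ` K) (lin_comb B x) \<partial>PiM B (\<lambda>_. lborel)) * gauss_mass ^ card D"
    by (rule nn_integral_multc) measurable
  also have "(\<integral>\<^sup>+x. indicator (orth_proj \<xi> ` K) (lin_comb B x) \<partial>PiM B (\<lambda>_. lborel))
      = (\<integral>\<^sup>+x. indicator (coord_preimage B (orth_proj \<xi> ` K)) x \<partial>PiM B (\<lambda>_. lborel))"
    by (intro nn_integral_cong) (auto simp: coord_preimage_def indicator_def)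
  also have "\<dots> = ennreal (proj_vol K \<xi>)"
    using emeasure_coord_preimage_finite[OF B compact_imp_bounded[OF compact_orth_proj[OF s(1) K]]]
    by (subst nn_integral_indicator) (auto intro!: sets_coord_preimage simp: v[OF K])
  finally show ?thesis using card by simp
qed

lemma continuous_on_matrix_vector_mult [continuous_intros]:
  fixes f :: "'a::topological_space \<Rightarrow> real ^ 'n ^ 'm" and g :: "'a \<Rightarrow> real ^ 'n"
  assumes "continuous_on S f" "continuous_on S g"
  shows "continuous_on S (\<lambda>x. f x *v g x)"
  unfolding matrix_vector_mult_def using assms by (intro continuous_intros continuous_on_vec_lambda)

lemma continuous_on_matrix_matrix_mult [continuous_intros]:
  fixes f :: "'a::topological_space \<Rightarrow> real ^ 'n ^ 'm" and g :: "'a \<Rightarrow> real ^ 'k ^ 'n"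
  assumes "continuous_on S f" "continuous_on S g"
  shows "continuous_on S (\<lambda>x. f x ** g x)"
  unfolding matrix_matrix_mult_def using assms by (intro continuous_intros continuous_on_vec_lambda)

text \<open>The Gaussian cylinder integral makes sense for an arbitrary matrix $A$ in place of the projection, and its
  integrand is measurable jointly in $A$ and $x$, because $\{(A, x) : A x \in A K\}$ is closed for
  compact $K$. This avoids choosing bases of the subspaces measurably.\<close>

lemma proj_vol_measurable:
  fixes K :: "(real ^ 'n) set"
  assumes K: "compact K"
  shows "proj_vol K \<in> borel_measurable (borel_grassmannian j)"
proof -
  define Z where "Z = {p :: (real ^ 'n ^ 'n) \<times> (real ^ 'n). \<exists>k. k \<in> K \<and> (k, p) \<in> {q. fst (snd q) *v snd (snd q) = fst (snd q) *v fst q}}"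
  have "closed Z"
    unfolding Z_def
  proof (rule closed_compact_projection[OF K])
    show "closed {q :: (real ^ 'n) \<times> (real ^ 'n ^ 'n) \<times> (real ^ 'n). fst (snd q) *v snd (snd q) = fst (snd q) *v fst q}"
      by (intro closed_Collect_eq continuous_intros)
  qed
  moreover have prod: "sets (borel \<Otimes>\<^sub>M lborel :: ((real ^ 'n ^ 'n) \<times> (real ^ 'n)) measure) = sets borel"
    using sets_pair_measure_cong[OF refl sets_lborel] borel_prod by metis
  ultimately have [measurable]: "Z \<in> sets (borel \<Otimes>\<^sub>M lborel)" by simp
  have "(\<lambda>p :: (real ^ 'n ^ 'n) \<times> (real ^ 'n). norm (snd p - fst p *v snd p)) \<in> borel_measurable borel"
    by (intro borel_measurable_continuous_onI continuous_intros)
  then have [measurable]: "(\<lambda>p :: (real ^ 'n ^ 'n) \<times> (real ^ 'n). norm (snd p - fst p *v snd p)) \<in> borel_measurable (borel \<Otimes>\<^sub>M lborel)"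
    by (subst measurable_cong_sets[OF prod refl])
  define \<Psi> where "\<Psi> A = (\<integral>\<^sup>+x. indicator Z (A, x) * gauss (norm (snd (A, x) - fst (A, x) *v snd (A, x))) \<partial>lborel)" for A :: "real ^ 'n ^ 'n"
  have "\<Psi> \<in> borel_measurable borel"
    unfolding \<Psi>_def
    by (rule lborel.borel_measurable_nn_integral) (simp add: case_prod_beta', measurable)
  then have "(\<lambda>A. enn2real (\<Psi> A / gauss_mass ^ (CARD('n) - j))) \<in> borel_measurable borel"
    by measurable
  then have "(\<lambda>\<xi>. enn2real (\<Psi> (matrix (orth_proj \<xi>)) / gauss_mass ^ (CARD('n) - j))) \<in> borel_measurable (borel_grassmannian j)"
    unfolding borel_grassmannian_def
    by (rule measurable_compose[OF measurable_vimage_algebra1, rotated]) auto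
  also have "?this \<longleftrightarrow> ?thesis"
  proof (rule measurable_cong)
    fix \<xi> :: "(real ^ 'n) set" assume "\<xi> \<in> space (borel_grassmannian j)"
    then have \<xi>: "\<xi> \<in> grassmannian j" by (simp add: borel_grassmannian_def)
    then have m: "matrix (orth_proj \<xi>) *v x = orth_proj \<xi> x" for x
      by (intro matrix_works) (auto simp: grassmannian_def linear_orth_proj linear_matrix_vector_mul_eq)
    have "\<Psi> (matrix (orth_proj \<xi>)) = (\<integral>\<^sup>+x. indicator (orth_proj \<xi> ` K) (orth_proj \<xi> x) * gauss (norm (x - orth_proj \<xi> x)) \<partial>lborel)"
      unfolding \<Psi>_def by (intro nn_integral_cong) (auto simp: Z_def m indicator_def)
    also note gauss_cylinder_proj_vol[OF \<xi> K]
    finally have e: "\<Psi> (matrix (orth_proj \<xi>)) = ennreal (proj_vol K \<xi>) * gauss_mass ^ (CARD('n) - j)" .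
    have "gauss_mass ^ (CARD('n) - j) \<noteq> 0" "gauss_mass ^ (CARD('n) - j) \<noteq> top"
      using gauss_mass_pos_finite by (auto simp: power_eq_top_ennreal)
    then have "\<Psi> (matrix (orth_proj \<xi>)) / gauss_mass ^ (CARD('n) - j) = ennreal (proj_vol K \<xi>)"
      unfolding e by (subst ennreal_mult_divide_eq) auto
    then show "enn2real (\<Psi> (matrix (orth_proj \<xi>)) / gauss_mass ^ (CARD('n) - j)) = proj_vol K \<xi>"
      by (simp add: proj_vol_def)
  qed
  finally show ?thesis .
qed

section \<open>Equality of projection volumes and rotation invariance\<close>

lemma proj_vol_pos:
  assumes "K \<in> convex_bodies_o" "\<xi> \<in> grassmannian j"
  shows "0 < proj_vol K \<xi>"
  using proj_vol_bounds[OF assms(1), of j] assms(2) by (metis less_le_trans)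

text \<open>A point of the larger projection outside the smaller one would, by convexity, have a whole
  relative ball near it that belongs to the difference and has positive volume.\<close>

lemma proj_vol_eq_imp_proj_eq:
  fixes \<xi> K L :: "(real ^ 'n) set"
  assumes \<xi>: "subspace \<xi>" and K: "compact K" and L: "L \<in> convex_bodies_o" and sub: "K \<subseteq> L"
    and eq: "proj_vol K \<xi> = proj_vol L \<xi>"
  shows "orth_proj \<xi> ` K = orth_proj \<xi> ` L"
proof (rule ccontr)
  assume "orth_proj \<xi> ` K \<noteq> orth_proj \<xi> ` L"
  then obtain p where p: "p \<in> orth_proj \<xi> ` L" "p \<notin> orth_proj \<xi> ` K" using sub by blast
  from L have L': "compact L" "convex L" "0 \<in> interior L" by (auto simp: convex_bodies_o_def)
  obtain r where r: "0 < r" "ball 0 r \<subseteq> L" using L'(3) by (auto simp: mem_interior)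
  note cK = compact_orth_proj[OF \<xi> K] and cL = compact_orth_proj[OF \<xi> L'(1)]
  have p\<xi>: "p \<in> \<xi>" using p(1) orth_proj_in[OF \<xi>] by auto
  have "open (- orth_proj \<xi> ` K)" using compact_imp_closed[OF cK] by auto
  then obtain \<delta> where \<delta>: "0 < \<delta>" "ball p \<delta> \<subseteq> - orth_proj \<xi> ` K"
    using p(2) by (meson ComplI openE)
  \<comment> \<open>Shrink towards \<open>p\<close> the ball around the origin that \<open>L\<close> contains.\<close>
  define \<tau> where "\<tau> = min 1 (\<delta> / (norm p + r))"
  have pr: "0 < norm p + r" using r norm_ge_zero[of p] by linarith
  have "\<tau> \<le> \<delta> / (norm p + r)" by (simp add: \<tau>_def)
  then have "\<tau> * (norm p + r) \<le> \<delta>" using pr by (simp add: pos_le_divide_eq)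
  moreover have "0 < \<tau>" "\<tau> \<le> 1" using \<delta> pr by (simp_all add: \<tau>_def)
  ultimately have \<tau>: "0 < \<tau>" "\<tau> \<le> 1" "\<tau> * (norm p + r) \<le> \<delta>" by blast+
  define q where "q = (1 - \<tau>) *\<^sub>R p"
  define S where "S = ball q (\<tau> * r) \<inter> \<xi>"
  have q\<xi>: "q \<in> \<xi>" unfolding q_def using \<xi> p\<xi> by (intro subspace_scale)
  have SL: "S \<subseteq> orth_proj \<xi> ` L"
  proof
    fix z assume z: "z \<in> S"
    define w where "w = (1 / \<tau>) *\<^sub>R (z - q)"
    have zw: "z = (1 - \<tau>) *\<^sub>R p + \<tau> *\<^sub>R w" using \<tau> by (simp add: w_def q_def)
    have "norm (z - q) < \<tau> * r" using z by (simp add: S_def dist_norm norm_minus_commute)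
    then have "norm w < r" using \<tau>(1) by (simp add: w_def divide_less_eq mult.commute)
    then have "w \<in> L" using r by auto
    moreover have "w \<in> \<xi>" unfolding w_def using z q\<xi> \<xi> by (intro subspace_scale subspace_diff) (auto simp: S_def)
    ultimately have "w \<in> orth_proj \<xi> ` L" using orth_proj_ident[OF \<xi>] by force
    then show "z \<in> orth_proj \<xi> ` L"
      unfolding zw using p(1) \<tau> convex_orth_proj[OF \<xi> L'(2)] by (intro convexD_alt) auto
  qed
  have SK: "S \<inter> orth_proj \<xi> ` K = {}"
  proof -
    have "z \<in> ball p \<delta>" if "z \<in> S" for z
    proof -
      have "dist p z \<le> dist p q + dist q z" by (rule dist_triangle)
      also have "dist p q = \<tau> * norm p" using \<tau> by (simp add: q_def dist_norm algebra_simps)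
      also have "\<tau> * norm p + dist q z < \<tau> * (norm p + r)" using that by (simp add: S_def algebra_simps)
      finally show ?thesis using \<tau> by simp
    qed
    then show ?thesis using \<delta>(2) by blast
  qed
  have Sb: "S \<in> sets borel" unfolding S_def using closed_subspace[OF \<xi>] by (intro sets.Int borel_open borel_closed) auto
  obtain B where B: "orthonormal_basis_of \<xi> B"
    and v: "\<And>K. compact K \<Longrightarrow> proj_vol K \<xi> = measure (PiM B (\<lambda>_. lborel)) (coord_preimage B (orth_proj \<xi> ` K))"
    using proj_vol_coords[OF \<xi>] by blast
  let ?e = "\<lambda>S. emeasure (PiM B (\<lambda>_. lborel)) (coord_preimage B S)"
  have "0 < ennreal ((2 * (\<tau> * r) / (card B + 1)) ^ card B)" using \<tau> r by simp
  also have "\<dots> \<le> ?e S" using \<tau> r by (intro coord_preimage_ball[OF B Sb q\<xi>]) (auto simp: S_def)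
  finally have pos: "0 < ?e S" .
  have "?e (orth_proj \<xi> ` K) + ?e S = emeasure (PiM B (\<lambda>_. lborel)) (coord_preimage B (orth_proj \<xi> ` K) \<union> coord_preimage B S)"
    using SK by (intro plus_emeasure sets_coord_preimage borel_compact cK Sb) (auto simp: coord_preimage_def)
  also have "\<dots> \<le> ?e (orth_proj \<xi> ` L)"
    using SL sub by (intro emeasure_mono sets_coord_preimage borel_compact cL) (auto simp: coord_preimage_def)
  also have "\<dots> = ?e (orth_proj \<xi> ` K)"
    using emeasure_coord_preimage_finite[OF B compact_imp_bounded[OF cK]]
      emeasure_coord_preimage_finite[OF B compact_imp_bounded[OF cL]] eq v[OF K] v[OF L'(1)] by simp
  finally have "?e (orth_proj \<xi> ` K) + ?e S \<le> ?e (orth_proj \<xi> ` K)" .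
  moreover have "?e (orth_proj \<xi> ` K) \<noteq> top"
    using emeasure_coord_preimage_finite[OF B compact_imp_bounded[OF cK]] by simp
  ultimately have "?e S = 0"
    by (metis add.right_neutral ennreal_add_left_cancel_le infinity_ennreal_def le_zero_eq)
  then show False using pos by simp
qed

lemma orth_proj_unique:
  fixes \<xi> :: "(real ^ 'n) set"
  assumes \<xi>: "subspace \<xi>" and y: "y \<in> \<xi>" "\<And>z. z \<in> \<xi> \<Longrightarrow> orthogonal (x - y) z"
  shows "orth_proj \<xi> x = y"
proof -
  let ?d = "orth_proj \<xi> x - y"
  have d: "?d \<in> \<xi>" using \<xi> y orth_proj_in[OF \<xi>] by (intro subspace_diff)
  have "?d \<bullet> ?d = (x - y) \<bullet> ?d - (x - orth_proj \<xi> x) \<bullet> ?d" by (simp add: inner_diff_left)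
  also have "\<dots> = 0" using y(2)[OF d] orthogonal_orth_proj[OF \<xi> d, of x] by (simp add: orthogonal_def)
  finally show ?thesis by simp
qed

text \<open>In terms of projection matrices an orthogonal map acts by conjugation, which is continuous;
  hence the action on the Grassmannian is measurable.\<close>

lemma orthogonal_image_grassmannian:
  fixes A :: "real ^ 'n ^ 'n"
  assumes A: "orthogonal_matrix A" and \<xi>: "\<xi> \<in> grassmannian j"
  shows "(*v) A ` \<xi> \<in> grassmannian j"
    and "matrix (orth_proj ((*v) A ` \<xi>)) = A ** matrix (orth_proj \<xi>) ** transpose A"
proof -
  have s: "subspace \<xi>" "dim \<xi> = j" using \<xi> by (auto simp: grassmannian_def)
  have AT: "transpose A ** A = mat 1" "A ** transpose A = mat 1"
    using A by (auto simp: orthogonal_matrix_def)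
  have inv: "transpose A *v (A *v x) = x" "A *v (transpose A *v x) = x" for x
    unfolding matrix_vector_mul_assoc AT by simp_all
  have inj: "inj ((*v) A)" by (rule injI) (metis inv(1))
  have sA: "subspace ((*v) A ` \<xi>)" using s(1) by (intro linear_subspace_image) auto
  show "(*v) A ` \<xi> \<in> grassmannian j"
    using sA s(2) dim_image_eq[of "(*v) A" \<xi>] inj by (auto simp: grassmannian_def inj_on_subset)
  have eq: "orth_proj ((*v) A ` \<xi>) x = A *v orth_proj \<xi> (transpose A *v x)" for x
  proof (rule orth_proj_unique[OF sA])
    show "A *v orth_proj \<xi> (transpose A *v x) \<in> (*v) A ` \<xi>" using orth_proj_in[OF s(1)] by auto
    fix z assume "z \<in> (*v) A ` \<xi>"
    then obtain w where w: "w \<in> \<xi>" "z = A *v w" by auto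
    have "(x - A *v orth_proj \<xi> (transpose A *v x)) \<bullet> (A *v w)
       = (transpose A *v (x - A *v orth_proj \<xi> (transpose A *v x))) \<bullet> w"
      unfolding transpose_matrix_vector by (rule dot_lmul_matrix[symmetric])
    also have "\<dots> = (transpose A *v x - orth_proj \<xi> (transpose A *v x)) \<bullet> w"
      by (simp only: matrix_vector_mult_diff_distrib inv)
    also have "\<dots> = 0" using orthogonal_orth_proj[OF s(1) w(1)] by (simp add: orthogonal_def)
    finally show "orthogonal (x - A *v orth_proj \<xi> (transpose A *v x)) z" by (simp add: w orthogonal_def)
  qed
  have m: "matrix (orth_proj \<xi>) *v x = orth_proj \<xi> x" for x
    using linear_orth_proj[OF s(1)] by (intro matrix_works) (auto simp: linear_matrix_vector_mul_eq)
  have m': "matrix (orth_proj ((*v) A ` \<xi>)) *v x = orth_proj ((*v) A ` \<xi>) x" for x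
    using linear_orth_proj[OF sA] by (intro matrix_works) (auto simp: linear_matrix_vector_mul_eq)
  show "matrix (orth_proj ((*v) A ` \<xi>)) = A ** matrix (orth_proj \<xi>) ** transpose A"
    by (subst matrix_eq) (simp only: m m' eq flip: matrix_vector_mul_assoc, simp)
qed

lemma rotation_measurable_grassmannian:
  fixes A :: "real ^ 'n ^ 'n"
  assumes A: "orthogonal_matrix A"
  shows "(\<lambda>\<xi>. (*v) A ` \<xi>) \<in> borel_grassmannian j \<rightarrow>\<^sub>M borel_grassmannian j"
  unfolding borel_grassmannian_def
proof (rule measurable_vimage_algebra2)
  show "(\<lambda>\<xi>. (*v) A ` \<xi>) \<in> space (vimage_algebra (grassmannian j) (\<lambda>\<xi>. matrix (orth_proj \<xi>)) borel) \<rightarrow> grassmannian j"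
    using orthogonal_image_grassmannian(1)[OF A] by auto
  have "(\<lambda>P. A ** P ** transpose A) \<in> borel_measurable borel"
    by (intro borel_measurable_continuous_onI continuous_intros)
  then have "(\<lambda>\<xi>. A ** matrix (orth_proj \<xi>) ** transpose A) \<in> vimage_algebra (grassmannian j) (\<lambda>\<xi>. matrix (orth_proj \<xi>)) borel \<rightarrow>\<^sub>M borel"
    by (rule measurable_compose[OF measurable_vimage_algebra1, rotated]) auto
  then show "(\<lambda>\<xi>. matrix (orth_proj ((*v) A ` \<xi>))) \<in> vimage_algebra (grassmannian j) (\<lambda>\<xi>. matrix (orth_proj \<xi>)) borel \<rightarrow>\<^sub>M borel"
    by (rule measurable_cong[THEN iffD1, rotated]) (simp add: orthogonal_image_grassmannian(2)[OF A])
qed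

lemma rotation_matrix_transitive:
  fixes x y :: "real ^ 'n"
  assumes "2 \<le> CARD('n)" "norm x = norm y"
  obtains A where "rotation_matrix A" "A *v x = y"
proof -
  obtain f where f: "orthogonal_transformation f" "det (matrix f) = 1" "f x = y"
    using rotation_exists[OF assms] by blast
  have "rotation_matrix (matrix f)"
    using f by (auto simp: rotation_matrix_def orthogonal_transformation_matrix)
  moreover have "matrix f *v x = y"
    using f by (simp add: matrix_works orthogonal_transformation_linear)
  ultimately show ?thesis using that by blast
qed

locale haar_grassmannian =
  fixes j :: nat and \<nu> :: "(real ^ 'n) set measure"
  assumes j: "1 \<le> j" "j \<le> CARD('n)" and haar: "grassmannian_haar j \<nu>"
begin

sublocale prob_space \<nu> using haar by (simp add: grassmannian_haar_def)

lemma sets_haar: "sets \<nu> = sets (borel_grassmannian j)"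
  using haar by (simp add: grassmannian_haar_def)

lemma space_haar: "space \<nu> = grassmannian j"
  using sets_eq_imp_space_eq[OF sets_haar] by (simp add: borel_grassmannian_def)

lemma AE_haar_obtain:
  assumes "AE \<xi> in \<nu>. Q \<xi>"
  obtains \<xi> where "\<xi> \<in> grassmannian j" "Q \<xi>"
proof (rule ccontr)
  assume "\<not> thesis"
  then have none: "\<not> (\<xi> \<in> grassmannian j \<and> Q \<xi>)" for \<xi> using that by blast
  from assms AE_space have "AE \<xi> in \<nu>. False"
    by eventually_elim (use none in \<open>auto simp: space_haar\<close>)
  then show False by (simp add: AE_const)
qed

text \<open>Finitely many rotated copies of the ball around $x$ cover the sphere through $x$. Outside a null
  set the property holds for the images of a subspace under the inverses of all these rotations, and the subspace
  meets one of the copies.\<close>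

lemma AE_haar_meets_ball:
  assumes Q: "AE \<xi> in \<nu>. Q \<xi>" and x: "x \<noteq> 0" and \<delta>: "0 < \<delta>"
  obtains \<xi> z where "\<xi> \<in> grassmannian j" "Q \<xi>" "z \<in> \<xi>" "z \<in> ball x \<delta>"
proof (cases "2 \<le> CARD('n)")
  case False
  \<comment> \<open>In dimension one the rotation group is trivial, but the only subspace of positive dimension is the whole line.\<close>
  then have "j = CARD('n)" using j by simp
  obtain \<xi> where \<xi>: "\<xi> \<in> grassmannian j" "Q \<xi>"
    using AE_haar_obtain[OF Q] .
  then have "\<xi> = UNIV" using \<open>j = CARD('n)\<close> dim_eq_full[of \<xi>] span_eq_iff[of \<xi>]
    by (simp add: grassmannian_def)
  then show ?thesis using that[OF \<xi>, of x] \<delta> by simp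
next
  case True
  define A where "A w = (SOME A. rotation_matrix A \<and> A *v x = w)" for w
  have A: "rotation_matrix (A w)" "A w *v x = w" if "norm w = norm x" for w
  proof -
    have "\<exists>A. rotation_matrix A \<and> A *v x = w" using rotation_matrix_transitive[OF True, of x w] that by metis
    from someI_ex[OF this] show "rotation_matrix (A w)" "A w *v x = w" by (auto simp: A_def)
  qed
  have "sphere (0 :: real ^ 'n) (norm x) \<subseteq> (\<Union>w\<in>sphere (0 :: real ^ 'n) (norm x). ball w \<delta>)" using \<delta> by auto
  then obtain W where W: "W \<subseteq> sphere (0 :: real ^ 'n) (norm x)" "finite W" "sphere (0 :: real ^ 'n) (norm x) \<subseteq> (\<Union>w\<in>W. ball w \<delta>)"
    by (rule compactE_image[OF compact_sphere open_ball])
  have "AE \<xi> in \<nu>. \<forall>w\<in>W. Q ((*v) (transpose (A w)) ` \<xi>)"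
  proof (rule AE_ball_countable[THEN iffD2, rule_format])
    show "countable W" using W(2) by (rule countable_finite)
    fix w assume "w \<in> W"
    then have "rotation_matrix (A w)" using A(1) W(1) by (auto simp: subset_iff)
    then have r: "rotation_matrix (transpose (A w))" by (simp add: rotation_matrix_def det_transpose)
    then have inv: "distr \<nu> \<nu> (\<lambda>\<xi>. (*v) (transpose (A w)) ` \<xi>) = \<nu>" using haar unfolding grassmannian_haar_def by blast
    have meas: "(\<lambda>\<xi>. (*v) (transpose (A w)) ` \<xi>) \<in> \<nu> \<rightarrow>\<^sub>M \<nu>"
      using rotation_measurable_grassmannian[of "transpose (A w)" j] r
      unfolding measurable_cong_sets[OF sets_haar sets_haar] rotation_matrix_def by blast
    have "AE \<xi> in distr \<nu> \<nu> (\<lambda>\<xi>. (*v) (transpose (A w)) ` \<xi>). Q \<xi>" using Q unfolding inv .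
    from AE_distrD[OF meas this] show "AE \<xi> in \<nu>. Q ((*v) (transpose (A w)) ` \<xi>)" .
  qed
  then obtain \<xi> where \<xi>: "\<xi> \<in> grassmannian j" "\<forall>w\<in>W. Q ((*v) (transpose (A w)) ` \<xi>)"
    by (rule AE_haar_obtain)
  have s: "subspace \<xi>" "dim \<xi> = j" using \<xi>(1) by (auto simp: grassmannian_def)
  obtain u where u: "u \<in> \<xi>" "u \<noteq> 0"
    using s j(1) dim_eq_0[of \<xi>] by (metis not_one_le_zero singletonI subsetI)
  define z where "z = (norm x / norm u) *\<^sub>R u"
  have z: "z \<in> \<xi>" "norm z = norm x" using u s by (auto simp: z_def subspace_scale)
  then obtain w where w: "w \<in> W" "z \<in> ball w \<delta>" using W(3) by auto
  then have nw: "norm w = norm x" using W(1) by auto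
  then have o: "orthogonal_matrix (transpose (A w))" using A(1) by (auto simp: rotation_matrix_def)
  have "orthogonal_transformation ((*v) (transpose (A w)))"
    using o by (simp add: orthogonal_transformation_matrix)
  then have "dist (transpose (A w) *v w) (transpose (A w) *v z) = dist w z"
    unfolding orthogonal_transformation_isometry by blast
  moreover have "transpose (A w) *v w = x"
    using A(2)[OF nw] o by (metis matrix_vector_mul_assoc matrix_vector_mul_lid orthogonal_matrix_def transpose_transpose)
  ultimately have "transpose (A w) *v z \<in> ball x \<delta>" using w(2) by simp
  then show ?thesis
    using that[OF orthogonal_image_grassmannian(1)[OF o \<xi>(1)] \<xi>(2)[rule_format, OF w(1)]] z(1) by blast
qed

end

section \<open>Affine quermassintegrals\<close>

lemma dilate_body:
  fixes K :: "(real ^ 'n) set"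
  assumes "K \<in> convex_bodies_o" "0 < c" shows "(\<lambda>x. c *\<^sub>R x) ` K \<in> convex_bodies_o"
proof -
  obtain r where r: "0 < r" "ball 0 r \<subseteq> K" using assms(1) by (auto simp: convex_bodies_o_def mem_interior)
  have "ball 0 (c * r) \<subseteq> (\<lambda>x. c *\<^sub>R x) ` K"
  proof
    fix x :: "real ^ 'n" assume "x \<in> ball 0 (c * r)"
    then have "(1 / c) *\<^sub>R x \<in> K" using r assms(2) by (auto simp: divide_less_eq mult.commute)
    then show "x \<in> (\<lambda>x. c *\<^sub>R x) ` K" by (simp add: dilate_mem_iff[OF assms(2)])
  qed
  then have "0 \<in> interior ((\<lambda>x. c *\<^sub>R x) ` K)" using r(1) assms(2) by (auto simp: mem_interior intro!: exI[of _ "c * r"])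
  then show ?thesis using assms by (auto simp: convex_bodies_o_def compact_scaling convex_scaling)
qed

context haar_grassmannian
begin

lemma integrable_proj_vol:
  assumes K: "K \<in> convex_bodies_o"
  shows "integrable \<nu> (\<lambda>\<xi>. proj_vol K \<xi> powr (- real CARD('n)))"
    and "0 < (\<integral>\<xi>. proj_vol K \<xi> powr (- real CARD('n)) \<partial>\<nu>)"
proof -
  have "compact K" using K by (simp add: convex_bodies_o_def)
  then have [measurable]: "proj_vol K \<in> borel_measurable \<nu>"
    using proj_vol_measurable[of K j] by (simp add: measurable_cong_sets[OF sets_haar refl])
  obtain lo hi where b: "0 < lo" "\<And>\<xi>. \<xi> \<in> grassmannian j \<Longrightarrow> lo \<le> proj_vol K \<xi> \<and> proj_vol K \<xi> \<le> hi"
    using proj_vol_bounds[OF K] by blast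
  have le: "hi powr (- real CARD('n)) \<le> proj_vol K \<xi> powr (- real CARD('n))
      \<and> proj_vol K \<xi> powr (- real CARD('n)) \<le> lo powr (- real CARD('n))" if "\<xi> \<in> space \<nu>" for \<xi>
    using b(1) b(2)[of \<xi>] that by (auto simp: space_haar intro!: powr_mono2')
  show int: "integrable \<nu> (\<lambda>\<xi>. proj_vol K \<xi> powr (- real CARD('n)))"
    using le by (intro integrable_const_bound[where B = "lo powr (- real CARD('n))"] AE_I2) auto
  have "hi > 0"
  proof -
    obtain \<xi> where "\<xi> \<in> space \<nu>" using not_empty by blast
    then show ?thesis using b(1) b(2)[of \<xi>] by (auto simp: space_haar)
  qed
  then have "0 < hi powr (- real CARD('n))" by simp
  also have "\<dots> \<le> (\<integral>\<xi>. proj_vol K \<xi> powr (- real CARD('n)) \<partial>\<nu>)"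
    using le by (intro integral_ge_const[OF int] AE_I2) auto
  finally show "0 < (\<integral>\<xi>. proj_vol K \<xi> powr (- real CARD('n)) \<partial>\<nu>)" .
qed

lemma ball_vol_ratio_pos: "0 < unit_ball_vol (real CARD('n)) / unit_ball_vol (real j)"
  by simp

lemma quermassintegral_pos: "K \<in> convex_bodies_o \<Longrightarrow> 0 < affine_quermassintegral \<nu> j K"
  unfolding affine_quermassintegral_def
  using integrable_proj_vol(2)[of K] ball_vol_ratio_pos by (intro mult_pos_pos) auto

lemma quermassintegral_le_iff:
  assumes "K \<in> convex_bodies_o" "L \<in> convex_bodies_o"
  shows "affine_quermassintegral \<nu> j K \<le> affine_quermassintegral \<nu> j L \<longleftrightarrow>
    (\<integral>\<xi>. proj_vol L \<xi> powr (- real CARD('n)) \<partial>\<nu>) \<le> (\<integral>\<xi>. proj_vol K \<xi> powr (- real CARD('n)) \<partial>\<nu>)"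
proof -
  let ?I = "\<lambda>K. \<integral>\<xi>. proj_vol K \<xi> powr (- real CARD('n)) \<partial>\<nu>"
  have a: "- 1 / real CARD('n) < 0" by simp
  have I: "0 < ?I K" "0 < ?I L" using integrable_proj_vol(2) assms by auto
  have "?I K powr (- 1 / real CARD('n)) \<le> ?I L powr (- 1 / real CARD('n)) \<longleftrightarrow> ?I L \<le> ?I K"
    using powr_less_mono2_neg[OF a I(1), of "?I L"] powr_mono2'[OF less_imp_le[OF a] I(2), of "?I K"] by linarith
  then show ?thesis
    unfolding affine_quermassintegral_def using ball_vol_ratio_pos by (simp only: mult_le_cancel_left_pos)
qed

lemma quermassintegral_dilate:
  assumes K: "K \<in> convex_bodies_o" and c: "0 < c"
  shows "affine_quermassintegral \<nu> j ((\<lambda>x. c *\<^sub>R x) ` K) = c ^ j * affine_quermassintegral \<nu> j K"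
proof -
  let ?n = "real CARD('n)"
  have "(\<integral>\<xi>. proj_vol ((\<lambda>x. c *\<^sub>R x) ` K) \<xi> powr (- ?n) \<partial>\<nu>) = (\<integral>\<xi>. (c ^ j) powr (- ?n) * proj_vol K \<xi> powr (- ?n) \<partial>\<nu>)"
  proof (rule Bochner_Integration.integral_cong)
    fix \<xi> assume "\<xi> \<in> space \<nu>"
    then have "subspace \<xi>" "dim \<xi> = j" "0 \<le> proj_vol K \<xi>" by (auto simp: space_haar grassmannian_def proj_vol_def)
    then show "proj_vol ((\<lambda>x. c *\<^sub>R x) ` K) \<xi> powr (- ?n) = (c ^ j) powr (- ?n) * proj_vol K \<xi> powr (- ?n)"
      using K c by (simp add: proj_vol_scale convex_bodies_o_def powr_mult)
  qed simp
  also have "\<dots> = (c ^ j) powr (- ?n) * (\<integral>\<xi>. proj_vol K \<xi> powr (- ?n) \<partial>\<nu>)" by simp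
  finally show ?thesis
    unfolding affine_quermassintegral_def using c integrable_proj_vol(2)[OF K]
    by (simp add: powr_mult powr_powr)
qed

lemma quermassintegral_mono:
  assumes K: "K \<in> convex_bodies_o" and L: "L \<in> convex_bodies_o" and sub: "K \<subseteq> L"
  shows "affine_quermassintegral \<nu> j K \<le> affine_quermassintegral \<nu> j L"
  unfolding quermassintegral_le_iff[OF K L]
proof (rule integral_mono[OF integrable_proj_vol(1)[OF L] integrable_proj_vol(1)[OF K]])
  fix \<xi> assume "\<xi> \<in> space \<nu>"
  then have \<xi>: "\<xi> \<in> grassmannian j" "subspace \<xi>" by (auto simp: space_haar grassmannian_def)
  have "proj_vol K \<xi> \<le> proj_vol L \<xi>"
    using K L sub \<xi>(2) by (intro proj_vol_mono) (auto simp: convex_bodies_o_def)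
  then show "proj_vol L \<xi> powr (- real CARD('n)) \<le> proj_vol K \<xi> powr (- real CARD('n))"
    using proj_vol_pos[OF K \<xi>(1)] by (intro powr_mono2') auto
qed

text \<open>Equal quermassintegrals force equal projections on almost every subspace. A point of $L$
  outside $K$ is separated from $K$ by an open set of directions, and some subspace with equal projections
  contains one of them.\<close>

lemma quermassintegral_strict_mono:
  assumes K: "K \<in> convex_bodies_o" and L: "L \<in> convex_bodies_o" and sub: "K \<subseteq> L"
    and eq: "affine_quermassintegral \<nu> j K = affine_quermassintegral \<nu> j L"
  shows "K = L"
proof (rule ccontr)
  assume "K \<noteq> L"
  then obtain p where p: "p \<in> L" "p \<notin> K" using sub by blast
  have K': "compact K" "convex K" "0 \<in> K" and L': "compact L"
    using K L interior_subset by (auto simp: convex_bodies_o_def)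
  let ?v = "\<lambda>K \<xi>. proj_vol K \<xi> powr (- real CARD('n))"
  have Ieq: "(\<integral>\<xi>. ?v K \<xi> \<partial>\<nu>) = (\<integral>\<xi>. ?v L \<xi> \<partial>\<nu>)"
    using eq quermassintegral_le_iff[OF K L] quermassintegral_le_iff[OF L K] by linarith
  have le: "?v L \<xi> \<le> ?v K \<xi>" if "\<xi> \<in> space \<nu>" for \<xi>
  proof -
    from that have \<xi>: "\<xi> \<in> grassmannian j" "subspace \<xi>" by (auto simp: space_haar grassmannian_def)
    show ?thesis using proj_vol_pos[OF K \<xi>(1)] proj_vol_mono[OF \<xi>(2) K'(1) L' sub] by (intro powr_mono2') auto
  qed
  have "AE \<xi> in \<nu>. ?v K \<xi> - ?v L \<xi> = 0"
    using integrable_proj_vol(1)[OF K] integrable_proj_vol(1)[OF L] Ieq le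
    by (subst integral_nonneg_eq_0_iff_AE[symmetric]) (auto intro!: AE_I2)
  then have "AE \<xi> in \<nu>. orth_proj \<xi> ` K = orth_proj \<xi> ` L"
    using AE_space
  proof eventually_elim
    case (elim \<xi>)
    then have \<xi>: "\<xi> \<in> grassmannian j" "subspace \<xi>" by (auto simp: space_haar grassmannian_def)
    have pos: "0 < proj_vol K \<xi>" "0 < proj_vol L \<xi>" using proj_vol_pos K L \<xi>(1) by auto
    have "proj_vol K \<xi> = ?v K \<xi> powr (- 1 / real CARD('n))" using pos by (simp add: powr_powr)
    also have "\<dots> = proj_vol L \<xi>" using pos elim by (simp add: powr_powr)
    finally show ?case by (intro proj_vol_eq_imp_proj_eq \<xi> K' L sub)
  qed
  moreover
  \<comment> \<open>A direction \<open>x\<close> separating \<open>p\<close> from \<open>K\<close>, and with it all directions near \<open>x\<close>.\<close>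
  obtain x b where xb: "x \<bullet> p < b" "\<forall>y\<in>K. x \<bullet> y > b"
    using separating_hyperplane_closed_point[OF K'(2) compact_imp_closed[OF K'(1)] p(2)] by blast
  \<comment> \<open>The bound \<open>e / (2 * R)\<close> on the change of direction moves each of the two inner products by less than \<open>e / 2\<close>.\<close>
  obtain R where R: "L \<subseteq> cball 0 R" "0 < R" using compact_subset_cball[OF L'] .
  have "b < 0" using xb(2) K'(3) by force
  then have "x \<noteq> 0" using xb(1) by auto
  define e where "e = b - x \<bullet> p"
  have e: "0 < e" using xb by (simp add: e_def)
  ultimately obtain \<xi> z where z: "\<xi> \<in> grassmannian j" "orth_proj \<xi> ` K = orth_proj \<xi> ` L" "z \<in> \<xi>" "z \<in> ball x (e / (2 * R))"
    using AE_haar_meets_ball[of "\<lambda>\<xi>. orth_proj \<xi> ` K = orth_proj \<xi> ` L" x "e / (2 * R)"] R(2) \<open>x \<noteq> 0\<close> by auto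
  have s: "subspace \<xi>" using z(1) by (simp add: grassmannian_def)
  obtain y where y: "y \<in> K" "orth_proj \<xi> p = orth_proj \<xi> y" using p(1) z(2) by blast
  have "z \<bullet> p = z \<bullet> y" using inner_orth_proj[OF s z(3), of p] inner_orth_proj[OF s z(3), of y] y(2) by simp
  then have "x \<bullet> y - x \<bullet> p = (x - z) \<bullet> y - (x - z) \<bullet> p" by (simp add: inner_diff_left)
  also have "\<dots> \<le> norm (x - z) * norm y + norm (x - z) * norm p"
    using norm_cauchy_schwarz[of "x - z" y] Cauchy_Schwarz_ineq2[of "x - z" p] by linarith
  also have "\<dots> \<le> norm (x - z) * R + norm (x - z) * R"
    using R y(1) p(1) sub by (intro add_mono mult_left_mono) (auto simp: subset_iff)
  also have "\<dots> < e" using z(4) R(2) by (simp add: dist_norm field_simps)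
  finally show False using xb(2) y(1) by (force simp: e_def)
qed

text \<open>The multiplicative inequality on each subspace, raised to the power $-n$ and combined with Young's
  inequality, bounds the integrand of $N$ by the convex combination of those of $K$ and $L$.\<close>

lemma quermassintegral_brunn_minkowski_normalized:
  assumes K: "K \<in> convex_bodies_o" and L: "L \<in> convex_bodies_o" and N: "N \<in> convex_bodies_o"
    and t: "0 < t" "t < 1" and eq: "affine_quermassintegral \<nu> j K = affine_quermassintegral \<nu> j L"
    and sum: "\<And>x y. x \<in> K \<Longrightarrow> y \<in> L \<Longrightarrow> (1 - t) *\<^sub>R x + t *\<^sub>R y \<in> N"
  shows "affine_quermassintegral \<nu> j K \<le> affine_quermassintegral \<nu> j N"
proof -
  let ?v = "\<lambda>K \<xi>. proj_vol K \<xi> powr (- real CARD('n))"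
  note int = integrable_proj_vol(1)
  have Ieq: "(\<integral>\<xi>. ?v K \<xi> \<partial>\<nu>) = (\<integral>\<xi>. ?v L \<xi> \<partial>\<nu>)"
    using eq quermassintegral_le_iff[OF K L] quermassintegral_le_iff[OF L K] by linarith
  have "(\<integral>\<xi>. ?v N \<xi> \<partial>\<nu>) \<le> (\<integral>\<xi>. (1 - t) * ?v K \<xi> + t * ?v L \<xi> \<partial>\<nu>)"
  proof (rule integral_mono)
    fix \<xi> assume "\<xi> \<in> space \<nu>"
    then have \<xi>: "\<xi> \<in> grassmannian j" "subspace \<xi>" by (auto simp: space_haar grassmannian_def)
    have pos: "0 < proj_vol K \<xi>" "0 < proj_vol L \<xi>" using proj_vol_pos K L \<xi>(1) by auto
    have "proj_vol K \<xi> powr (1 - t) * proj_vol L \<xi> powr t \<le> proj_vol N \<xi>"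
      using K L N t sum by (intro proj_vol_brunn_minkowski \<xi>) (auto simp: convex_bodies_o_def)
    then have "?v N \<xi> \<le> (proj_vol K \<xi> powr (1 - t) * proj_vol L \<xi> powr t) powr (- real CARD('n))"
      using pos by (intro powr_mono2') auto
    also have "\<dots> = ?v K \<xi> powr (1 - t) * ?v L \<xi> powr t"
      using pos by (simp add: powr_mult powr_powr mult.commute)
    also have "\<dots> \<le> (1 - t) * ?v K \<xi> + t * ?v L \<xi>"
      using pos t by (intro Youngs_inequality_0) auto
    finally show "?v N \<xi> \<le> (1 - t) * ?v K \<xi> + t * ?v L \<xi>" .
  qed (use int[OF K] int[OF L] int[OF N] in auto)
  also have "\<dots> = (1 - t) * (\<integral>\<xi>. ?v K \<xi> \<partial>\<nu>) + t * (\<integral>\<xi>. ?v L \<xi> \<partial>\<nu>)"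
    using int[OF K] int[OF L] by simp
  also have "\<dots> = (\<integral>\<xi>. ?v K \<xi> \<partial>\<nu>)" unfolding Ieq by (simp add: algebra_simps)
  finally show ?thesis using quermassintegral_le_iff[OF K N] by simp
qed

text \<open>The homogeneous version, of degree one under dilation.\<close>

definition quermass_radius :: "(real ^ 'n) set \<Rightarrow> real" where
  "quermass_radius K = affine_quermassintegral \<nu> j K powr (1 / real j)"

lemma quermass_radius_pos: "K \<in> convex_bodies_o \<Longrightarrow> 0 < quermass_radius K"
  using quermassintegral_pos[of K] by (simp add: quermass_radius_def)

lemma quermass_radius_power: "K \<in> convex_bodies_o \<Longrightarrow> quermass_radius K ^ j = affine_quermassintegral \<nu> j K"
  using quermassintegral_pos[of K] j by (simp add: quermass_radius_def powr_powr flip: powr_realpow)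

lemma quermass_radius_dilate:
  assumes "K \<in> convex_bodies_o" "0 < c"
  shows "quermass_radius ((\<lambda>x. c *\<^sub>R x) ` K) = c * quermass_radius K"
  unfolding quermass_radius_def quermassintegral_dilate[OF assms]
  using assms(2) j quermassintegral_pos[OF assms(1)] by (simp add: powr_mult powr_powr flip: powr_realpow)

lemma quermass_radius_mono:
  assumes "K \<in> convex_bodies_o" "L \<in> convex_bodies_o" "K \<subseteq> L"
  shows "quermass_radius K \<le> quermass_radius L"
  unfolding quermass_radius_def
  using quermassintegral_mono[OF assms] quermassintegral_pos[OF assms(1)] by (intro powr_mono2) auto

text \<open>Dividing $K$ and $L$ by their own radii makes the quermassintegrals equal to $1$; the factor
  $s = a\rho(K) + b\rho(L)$ is then exactly what turns the coefficients into a convex combination.\<close>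

lemma quermass_radius_brunn_minkowski_pos:
  assumes K: "K \<in> convex_bodies_o" and L: "L \<in> convex_bodies_o" and N: "N \<in> convex_bodies_o"
    and ab: "0 < a" "0 < b"
    and sum: "\<And>x y. x \<in> K \<Longrightarrow> y \<in> L \<Longrightarrow> a *\<^sub>R x + b *\<^sub>R y \<in> N"
  shows "a * quermass_radius K + b * quermass_radius L \<le> quermass_radius N"
proof -
  define \<alpha> \<beta> where "\<alpha> = quermass_radius K" and "\<beta> = quermass_radius L"
  have pos: "0 < \<alpha>" "0 < \<beta>" using quermass_radius_pos K L by (auto simp: \<alpha>_def \<beta>_def)
  define s where "s = a * \<alpha> + b * \<beta>"
  define t where "t = b * \<beta> / s"
  have s: "0 < s" using pos ab by (simp add: s_def add_pos_pos)
  have "1 - t = (s - b * \<beta>) / s" using s by (simp add: t_def diff_divide_distrib)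
  then have t3: "1 - t = a * \<alpha> / s" by (simp add: s_def)
  moreover have "0 < t" "0 < a * \<alpha> / s" using pos ab s by (simp_all add: t_def)
  ultimately have t: "0 < t" "t < 1" "1 - t = a * \<alpha> / s" by linarith+
  let ?K = "(\<lambda>x. (1 / \<alpha>) *\<^sub>R x) ` K" and ?L = "(\<lambda>x. (1 / \<beta>) *\<^sub>R x) ` L" and ?N = "(\<lambda>x. (1 / s) *\<^sub>R x) ` N"
  have bodies: "?K \<in> convex_bodies_o" "?L \<in> convex_bodies_o" "?N \<in> convex_bodies_o"
    using K L N pos s by (auto intro!: dilate_body)
  have one: "affine_quermassintegral \<nu> j ?K = 1" "affine_quermassintegral \<nu> j ?L = 1"
    using K L pos by (simp_all add: quermassintegral_dilate \<alpha>_def \<beta>_def power_divide quermass_radius_power quermassintegral_pos[THEN less_imp_neq, symmetric])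
  have "affine_quermassintegral \<nu> j ?K \<le> affine_quermassintegral \<nu> j ?N"
  proof (rule quermassintegral_brunn_minkowski_normalized[OF bodies t(1,2)])
    fix x y assume "x \<in> ?K" "y \<in> ?L"
    then obtain k l where kl: "k \<in> K" "l \<in> L" "x = (1 / \<alpha>) *\<^sub>R k" "y = (1 / \<beta>) *\<^sub>R l" by blast
    have "(1 - t) *\<^sub>R x + t *\<^sub>R y = (1 / s) *\<^sub>R (a *\<^sub>R k + b *\<^sub>R l)"
      unfolding t(3) using pos s by (simp add: kl t_def scaleR_add_right)
    then show "(1 - t) *\<^sub>R x + t *\<^sub>R y \<in> ?N" using sum[OF kl(1,2)] by blast
  qed (use one in auto)
  then have "1 \<le> affine_quermassintegral \<nu> j ?N" using one by simp
  then have "1 \<le> quermass_radius ?N" by (simp add: quermass_radius_def ge_one_powr_ge_zero)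
  then have "1 \<le> (1 / s) * quermass_radius N" using quermass_radius_dilate[OF N, of "1 / s"] s by simp
  then show ?thesis using s by (simp add: s_def \<alpha>_def \<beta>_def field_simps)
qed

lemma quermass_radius_brunn_minkowski:
  assumes K: "K \<in> convex_bodies_o" and L: "L \<in> convex_bodies_o" and N: "N \<in> convex_bodies_o"
    and ab: "0 \<le> a" "0 \<le> b"
    and sum: "\<And>x y. x \<in> K \<Longrightarrow> y \<in> L \<Longrightarrow> a *\<^sub>R x + b *\<^sub>R y \<in> N"
  shows "a * quermass_radius K + b * quermass_radius L \<le> quermass_radius N"
proof -
  have 0: "0 \<in> K" "0 \<in> L" using K L interior_subset by (auto simp: convex_bodies_o_def)
  have dil: "c * quermass_radius M \<le> quermass_radius N"
    if M: "M \<in> convex_bodies_o" and c: "0 < c" and sub: "\<And>x. x \<in> M \<Longrightarrow> c *\<^sub>R x \<in> N" for c M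
    using quermass_radius_mono[OF dilate_body[OF M c] N] sub quermass_radius_dilate[OF M c] by auto
  consider "a = 0" "b = 0" | "a = 0" "0 < b" | "0 < a" "b = 0" | "0 < a" "0 < b" using ab by linarith
  then show ?thesis
  proof cases
    case 1 then show ?thesis using quermass_radius_pos[OF N] by simp
  next
    case 2 then show ?thesis using dil[OF L] sum[OF 0(1)] by simp
  next
    case 3 then show ?thesis using dil[OF K] sum[OF _ 0(2)] by simp
  next
    case 4 then show ?thesis by (intro quermass_radius_brunn_minkowski_pos assms)
  qed
qed

end

section \<open>Support functions\<close>

lemma support_fun_ge:
  fixes K :: "(real ^ 'n) set"
  assumes "compact K" "y \<in> K" shows "x \<bullet> y \<le> support_fun K x"
proof -
  have "compact ((\<lambda>y. x \<bullet> y) ` K)" using assms(1) by (intro compact_continuous_image continuous_intros)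
  then have "bdd_above ((\<lambda>y. x \<bullet> y) ` K)" by (intro bounded_imp_bdd_above compact_imp_bounded)
  then show ?thesis unfolding support_fun_def using assms(2) by (rule cSUP_upper2) simp
qed

lemma support_fun_least:
  fixes K :: "(real ^ 'n) set"
  assumes "K \<noteq> {}" "\<And>y. y \<in> K \<Longrightarrow> x \<bullet> y \<le> c" shows "support_fun K x \<le> c"
  unfolding support_fun_def using assms by (intro cSUP_least)

lemma support_fun_attained:
  fixes K :: "(real ^ 'n) set"
  assumes "compact K" "K \<noteq> {}" obtains y where "y \<in> K" "support_fun K x = x \<bullet> y"
proof -
  have "continuous_on K (\<lambda>y. x \<bullet> y)" by (intro continuous_intros)
  then obtain y where y: "y \<in> K" "\<forall>z\<in>K. x \<bullet> z \<le> x \<bullet> y"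
    using continuous_attains_sup[OF assms] by blast
  then have "support_fun K x = x \<bullet> y"
    using support_fun_ge[OF assms(1) y(1), of x] support_fun_least[OF assms(2)] by (meson order_antisym)
  with y that show ?thesis by blast
qed

lemma mem_iff_support_fun:
  fixes K :: "(real ^ 'n) set"
  assumes "compact K" "convex K"  "K \<noteq> {}"
  shows "y \<in> K \<longleftrightarrow> (\<forall>x. x \<bullet> y \<le> support_fun K x)"
proof
  assume y: "\<forall>x. x \<bullet> y \<le> support_fun K x"
  show "y \<in> K"
  proof (rule ccontr)
    assume "y \<notin> K"
    then obtain a b where ab: "a \<bullet> y < b" "\<forall>x\<in>K. a \<bullet> x > b"
      using separating_hyperplane_closed_point[OF assms(2) compact_imp_closed[OF assms(1)]] by blast
    have "support_fun K (- a) \<le> - b" using ab(2) by (intro support_fun_least assms(3)) auto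
    with y[rule_format, of "- a"] ab(1) show False by simp
  qed
qed (use support_fun_ge assms in blast)

lemma convex_bodies_oD:
  fixes K :: "(real ^ 'n) set"
  assumes "K \<in> convex_bodies_o"
  shows "compact K" "convex K" "0 \<in> K" "K \<noteq> {}"
  using assms interior_subset by (auto simp: convex_bodies_o_def)

lemma body_eqI:
  fixes K L :: "(real ^ 'n) set"
  assumes "K \<in> convex_bodies_o" "L \<in> convex_bodies_o" "\<And>x. x \<noteq> 0 \<Longrightarrow> support_fun K x = support_fun L x"
  shows "K = L"
proof -
  have "support_fun K 0 = 0" "support_fun L 0 = 0"
    using convex_bodies_oD[OF assms(1)] convex_bodies_oD[OF assms(2)] by (auto simp: support_fun_def)
  then have "support_fun K x = support_fun L x" for x using assms(3) by (cases "x = 0") auto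
  then show ?thesis
    by (intro set_eqI) (simp add: mem_iff_support_fun[OF convex_bodies_oD(1,2,4)[OF assms(1)]]
      mem_iff_support_fun[OF convex_bodies_oD(1,2,4)[OF assms(2)]])
qed

lemma support_fun_pos:
  fixes K :: "(real ^ 'n) set"
  assumes K: "K \<in> convex_bodies_o" and x: "x \<noteq> 0"
  shows "0 < support_fun K x"
proof -
  obtain r where r: "0 < r" "ball 0 r \<subseteq> K" using K by (auto simp: convex_bodies_o_def mem_interior)
  let ?y = "(r / (2 * norm x)) *\<^sub>R x"
  have "?y \<in> K" using r x by auto
  from support_fun_ge[OF convex_bodies_oD(1)[OF K] this, of x] have "r / (2 * norm x) * (x \<bullet> x) \<le> support_fun K x" by simp
  moreover have "0 < r / (2 * norm x) * (x \<bullet> x)" using r x by simp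
  ultimately show ?thesis by linarith
qed

lemma support_fun_0:
  fixes K :: "(real ^ 'n) set"
  assumes "K \<in> convex_bodies_o" shows "support_fun K 0 = 0"
  using convex_bodies_oD(4)[OF assms] by (auto simp: support_fun_def)

lemma support_fun_dilate:
  fixes K :: "(real ^ 'n) set"
  assumes K: "K \<in> convex_bodies_o" and c: "0 < c"
  shows "support_fun ((\<lambda>x. c *\<^sub>R x) ` K) x = c * support_fun K x"
proof (rule order_antisym)
  note K' = convex_bodies_oD[OF K]
  show "support_fun ((\<lambda>x. c *\<^sub>R x) ` K) x \<le> c * support_fun K x"
    using K' c support_fun_ge[OF K'(1), of _ x] by (intro support_fun_least) (auto intro!: mult_left_mono)
  obtain y where y: "y \<in> K" "support_fun K x = x \<bullet> y" using support_fun_attained[OF K'(1,4)] .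
  show "c * support_fun K x \<le> support_fun ((\<lambda>x. c *\<^sub>R x) ` K) x"
    using support_fun_ge[OF compact_scaling[OF K'(1), of c], of "c *\<^sub>R y" x] y by auto
qed

definition mink_comb :: "real \<Rightarrow> (real ^ 'n) set \<Rightarrow> real \<Rightarrow> (real ^ 'n) set \<Rightarrow> (real ^ 'n) set" where
  "mink_comb a K b L = (\<lambda>(x, y). a *\<^sub>R x + b *\<^sub>R y) ` (K \<times> L)"

lemma mink_comb_body:
  fixes K L :: "(real ^ 'n) set"
  assumes K: "K \<in> convex_bodies_o" and L: "L \<in> convex_bodies_o" and ab: "0 < a" "0 < b"
  shows "mink_comb a K b L \<in> convex_bodies_o"
proof -
  note K' = convex_bodies_oD[OF K] and L' = convex_bodies_oD[OF L]
  have lin: "linear (\<lambda>(x, y). a *\<^sub>R x + b *\<^sub>R y :: real ^ 'n)"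
    by (rule linearI) (auto simp: algebra_simps)
  have "compact (mink_comb a K b L)" unfolding mink_comb_def
    using lin K' L' by (intro compact_continuous_image compact_Times linear_continuous_on) (auto simp: linear_linear)
  moreover have "convex (mink_comb a K b L)" unfolding mink_comb_def
    using lin K' L' by (intro convex_linear_image convex_Times)
  moreover have "0 \<in> interior (mink_comb a K b L)"
  proof -
    obtain r where r: "0 < r" "ball 0 r \<subseteq> K" using K by (auto simp: convex_bodies_o_def mem_interior)
    have "ball 0 (a * r) \<subseteq> mink_comb a K b L"
    proof
      fix x :: "real ^ 'n" assume "x \<in> ball 0 (a * r)"
      then have "(1 / a) *\<^sub>R x \<in> K" using r ab by (auto simp: divide_less_eq mult.commute)
      moreover have "x = a *\<^sub>R ((1 / a) *\<^sub>R x) + b *\<^sub>R 0" using ab by simp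
      ultimately show "x \<in> mink_comb a K b L" using L'(3) unfolding mink_comb_def
        by (intro image_eqI[where x = "((1 / a) *\<^sub>R x, 0)"]) auto
    qed
    then show ?thesis using r ab by (auto simp: mem_interior intro!: exI[of _ "a * r"])
  qed
  ultimately show ?thesis by (simp add: convex_bodies_o_def)
qed

lemma support_fun_mink_comb:
  fixes K L :: "(real ^ 'n) set"
  assumes K: "K \<in> convex_bodies_o" and L: "L \<in> convex_bodies_o" and ab: "0 < a" "0 < b"
  shows "support_fun (mink_comb a K b L) x = a * support_fun K x + b * support_fun L x"
proof (rule order_antisym)
  note K' = convex_bodies_oD[OF K] and L' = convex_bodies_oD[OF L]
  note N' = convex_bodies_oD[OF mink_comb_body[OF assms]]
  show "support_fun (mink_comb a K b L) x \<le> a * support_fun K x + b * support_fun L x"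
  proof (rule support_fun_least[OF N'(4)])
    fix y assume "y \<in> mink_comb a K b L"
    then obtain k l where "k \<in> K" "l \<in> L" "y = a *\<^sub>R k + b *\<^sub>R l" by (auto simp: mink_comb_def)
    then show "x \<bullet> y \<le> a * support_fun K x + b * support_fun L x"
      using support_fun_ge[OF K'(1), of k x] support_fun_ge[OF L'(1), of l x] ab
      by (simp add: inner_add_right add_mono)
  qed
  obtain k where k: "k \<in> K" "support_fun K x = x \<bullet> k" using support_fun_attained[OF K'(1,4)] .
  obtain l where l: "l \<in> L" "support_fun L x = x \<bullet> l" using support_fun_attained[OF L'(1,4)] .
  have "a *\<^sub>R k + b *\<^sub>R l \<in> mink_comb a K b L" using k l by (auto simp: mink_comb_def)
  from support_fun_ge[OF N'(1) this, of x]
  show "a * support_fun K x + b * support_fun L x \<le> support_fun (mink_comb a K b L) x"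
    by (simp add: k l inner_add_right)
qed

section \<open>Orlicz combinations\<close>

lemma orlicz_classD:
  assumes "\<phi> \<in> orlicz_class"
  shows "\<And>x. 0 \<le> x \<Longrightarrow> 0 \<le> \<phi> x" "\<And>x y. 0 \<le> x \<Longrightarrow> x \<le> y \<Longrightarrow> \<phi> x \<le> \<phi> y"
    "convex_on {0..} \<phi>" "\<phi> 0 = 0" "\<phi> 1 = 1"
  using assms by (auto simp: orlicz_class_def mono_on_def)

text \<open>Convexity together with $\varphi(0) = 0$.\<close>

lemma orlicz_star_shaped:
  assumes \<phi>: "\<phi> \<in> orlicz_class" and "0 \<le> c" "c \<le> 1" "0 \<le> x"
  shows "\<phi> (c * x) \<le> c * \<phi> x"
  using convex_onD[OF orlicz_classD(3)[OF \<phi>], of c 0 x] assms orlicz_classD(4)[OF \<phi>] by simp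

lemma orlicz_subgradient:
  assumes \<phi>: "\<phi> \<in> orlicz_class" and u: "0 < u"
  obtains s where "0 \<le> s" "\<phi> u \<le> s * u" "\<forall>x\<ge>0. \<phi> u + s * (x - u) \<le> \<phi> x"
proof -
  have i: "u \<in> interior {0::real..}" using u by simp
  define s where "s = Inf ((\<lambda>t. (\<phi> u - \<phi> t) / (u - t)) ` ({u<..} \<inter> {0..}))"
  have s: "\<phi> u + s * (x - u) \<le> \<phi> x" if "0 \<le> x" for x
    unfolding s_def using convex_le_Inf_differential[OF orlicz_classD(3)[OF \<phi>] i, of x] that by simp
  have le: "\<phi> u \<le> s * u" using s[of 0] orlicz_classD(4)[OF \<phi>] by simp
  then have "0 \<le> s * u" using orlicz_classD(1)[OF \<phi>, of u] u by linarith
  then have "0 \<le> s" using u by (simp add: zero_le_mult_iff)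
  then show ?thesis using that s le by blast
qed

text \<open>A supporting line of the convex function $\varphi(x) + \varepsilon\varphi(y)$ at $(u, v)$, with slopes
  $(s, \varepsilon t)$; comparison with the value $0$ at the origin bounds the slopes from below.\<close>

lemma orlicz_tangent_line:
  assumes \<phi>: "\<phi> \<in> orlicz_class" and e: "0 < \<epsilon>" and uv: "0 < u" "0 < v"
  obtains s t where "0 \<le> s" "0 \<le> t" "\<phi> u \<le> s * u" "\<phi> v \<le> t * v"
    "\<forall>x\<ge>0. \<forall>y\<ge>0. \<phi> u + \<epsilon> * \<phi> v + (s * x + \<epsilon> * t * y - (s * u + \<epsilon> * t * v)) \<le> \<phi> x + \<epsilon> * \<phi> y"
proof -
  obtain s where s: "0 \<le> s" "\<phi> u \<le> s * u" "\<forall>x\<ge>0. \<phi> u + s * (x - u) \<le> \<phi> x"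
    using orlicz_subgradient[OF \<phi> uv(1)] .
  obtain t where t: "0 \<le> t" "\<phi> v \<le> t * v" "\<forall>x\<ge>0. \<phi> v + t * (x - v) \<le> \<phi> x"
    using orlicz_subgradient[OF \<phi> uv(2)] .
  have "\<phi> u + \<epsilon> * \<phi> v + (s * x + \<epsilon> * t * y - (s * u + \<epsilon> * t * v)) \<le> \<phi> x + \<epsilon> * \<phi> y"
    if "0 \<le> x" "0 \<le> y" for x y
  proof -
    have "(\<phi> u + s * (x - u)) + \<epsilon> * (\<phi> v + t * (y - v)) \<le> \<phi> x + \<epsilon> * \<phi> y"
      using s(3) t(3) that e by (intro add_mono mult_left_mono) auto
    then show ?thesis by (simp add: algebra_simps)
  qed
  then show ?thesis using that s t by blast
qed

lemma orlicz_tangent_bound: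
  fixes \<phi> :: "real \<Rightarrow> real"
  assumes tan: "\<forall>x\<ge>0. \<forall>y\<ge>0. g + (s * x + \<epsilon> * t * y - D) \<le> \<phi> x + \<epsilon> * \<phi> y"
    and pos: "0 < k" "0 < l" "0 < h" and one: "\<phi> (k / h) + \<epsilon> * \<phi> (l / h) = 1"
  shows "s * k + \<epsilon> * t * l \<le> (D + 1 - g) * h"
proof -
  have "0 \<le> k / h" "0 \<le> l / h" using pos by auto
  then have "g + (s * (k / h) + \<epsilon> * t * (l / h) - D) \<le> 1" using tan one by metis
  then have "(s * (k / h) + \<epsilon> * t * (l / h)) * h \<le> (D + 1 - g) * h"
    using pos by (intro mult_right_mono) auto
  then show ?thesis using pos by (simp add: algebra_simps)
qed

text \<open>The intermediate value theorem: on the left end the first term alone is $1$, and on the right end both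
  arguments are at most $1$, where $\varphi(x) \le x$.\<close>

lemma orlicz_norm:
  assumes \<phi>: "\<phi> \<in> orlicz_class" and e: "0 < \<epsilon>" and kl: "0 < k" "0 < l"
  obtains m where "k \<le> m" "m \<le> k + l + \<epsilon> * l" "\<phi> (k / m) + \<epsilon> * \<phi> (l / m) = 1"
proof -
  let ?F = "\<lambda>m. \<phi> (k / m) + \<epsilon> * \<phi> (l / m)"
  let ?b = "k + l + \<epsilon> * l"
  note \<phi>' = orlicz_classD[OF \<phi>]
  have lin: "\<phi> x \<le> x" if "0 \<le> x" "x \<le> 1" for x
    using orlicz_star_shaped[OF \<phi> that, of 1] \<phi>'(5) by simp
  have kb: "k \<le> ?b" "0 < ?b" using kl e by (auto intro: add_pos_pos)
  have cont: "continuous_on {0<..} \<phi>"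
    by (intro convex_on_continuous convex_on_subset[OF \<phi>'(3)]) auto
  have "continuous_on {k..?b} (\<lambda>m. \<phi> (c / m))" if "0 < c" for c
  proof (rule continuous_on_compose2[OF cont])
    show "continuous_on {k..?b} (\<lambda>m. c / m)" using kl by (intro continuous_intros) auto
  qed (use that kl in auto)
  then have "continuous_on {k..?b} ?F" using kl by (intro continuous_on_add continuous_on_mult_left) auto
  moreover have "1 \<le> ?F k" using kl e \<phi>'(1)[of "l / k"] \<phi>'(5) by simp
  moreover have "?F ?b \<le> 1"
  proof -
    have "?F ?b \<le> k / ?b + \<epsilon> * (l / ?b)"
      using kl e kb by (intro add_mono mult_left_mono lin) (auto simp: divide_le_eq_1)
    also have "\<dots> = (k + \<epsilon> * l) / ?b" by (simp add: add_divide_distrib)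
    also have "\<dots> \<le> 1" using kl kb by (simp add: divide_le_eq_1)
    finally show ?thesis .
  qed
  ultimately obtain m where "k \<le> m" "m \<le> ?b" "?F m = 1" using IVT2'[of ?F ?b 1 k] kb(1) by blast
  then show ?thesis using that by blast
qed

text \<open>A root of the defining equation is the smallest admissible value even where $\varphi$ is not strictly
  increasing: by star-shapedness the left side grows at least like $1/x$ as $x$ decreases below $m$.\<close>

lemma orlicz_norm_Inf:
  assumes \<phi>: "\<phi> \<in> orlicz_class" and e: "0 < \<epsilon>" and kl: "0 < k" "0 < l"
    and m: "0 < m" "\<phi> (k / m) + \<epsilon> * \<phi> (l / m) = 1"
  shows "Inf {x. x > 0 \<and> \<phi> (k / x) + \<epsilon> * \<phi> (l / x) \<le> 1} = m"
proof (rule cInf_eq_minimum)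
  show "m \<in> {x. x > 0 \<and> \<phi> (k / x) + \<epsilon> * \<phi> (l / x) \<le> 1}" using m by simp
  fix x assume x: "x \<in> {x. x > 0 \<and> \<phi> (k / x) + \<epsilon> * \<phi> (l / x) \<le> 1}"
  show "m \<le> x"
  proof (rule ccontr)
    assume "\<not> m \<le> x"
    then have c: "0 \<le> x / m" "x / m < 1" "0 < x" using x m by auto
    have "\<phi> (k / m) \<le> (x / m) * \<phi> (k / x)" "\<phi> (l / m) \<le> (x / m) * \<phi> (l / x)"
      using orlicz_star_shaped[OF \<phi> c(1), of "k / x"] orlicz_star_shaped[OF \<phi> c(1), of "l / x"] c kl by auto
    then have "1 \<le> (x / m) * \<phi> (k / x) + \<epsilon> * ((x / m) * \<phi> (l / x))"
      unfolding m(2)[symmetric] using e by (intro add_mono mult_left_mono) auto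
    also have "\<dots> = (x / m) * (\<phi> (k / x) + \<epsilon> * \<phi> (l / x))" by (simp add: algebra_simps)
    also have "\<dots> \<le> x / m" using x c(1) by (intro mult_left_le) auto
    finally show False using c by simp
  qed
qed

text \<open>Let $M$ be the intersection of the half-spaces given by the defining function $h$. That the support
  function of $M$ reaches $h(x)$ needs a point of $M$ on the corresponding hyperplane. The tangent line at
  $(h_K(x)/h(x), h_L(x)/h(x))$ provides one: the suitably scaled combination of the points of $K$ and $L$
  that attain $h_K(x)$ and $h_L(x)$.\<close>

lemma orlicz_comb_ex:
  fixes K L :: "(real ^ 'n) set"
  assumes \<phi>: "\<phi> \<in> orlicz_class" and e: "0 < \<epsilon>" and K: "K \<in> convex_bodies_o" and L: "L \<in> convex_bodies_o"
  shows "orlicz_comb \<phi> K \<epsilon> L \<in> convex_bodies_o \<and> (\<forall>x. support_fun (orlicz_comb \<phi> K \<epsilon> L) x =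
        Inf {l. l > 0 \<and> \<phi> (support_fun K x / l) + \<epsilon> * \<phi> (support_fun L x / l) \<le> 1})"
proof -
  note K' = convex_bodies_oD[OF K] and L' = convex_bodies_oD[OF L]
  define h where "h x = Inf {l. l > 0 \<and> \<phi> (support_fun K x / l) + \<epsilon> * \<phi> (support_fun L x / l) \<le> 1}" for x
  have h0: "h 0 = 0"
  proof -
    have "{l. l > 0 \<and> \<phi> (support_fun K 0 / l) + \<epsilon> * \<phi> (support_fun L 0 / l) \<le> 1} = {0<..}"
      using orlicz_classD(4)[OF \<phi>] by (auto simp: support_fun_0 K L)
    then show ?thesis by (simp add: h_def)
  qed
  have h: "support_fun K x \<le> h x \<and> h x \<le> support_fun K x + support_fun L x + \<epsilon> * support_fun L x \<and>
      \<phi> (support_fun K x / h x) + \<epsilon> * \<phi> (support_fun L x / h x) = 1" if x: "x \<noteq> 0" for x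
  proof -
    note pos = support_fun_pos[OF K x] support_fun_pos[OF L x]
    obtain m where m: "support_fun K x \<le> m" "m \<le> support_fun K x + support_fun L x + \<epsilon> * support_fun L x"
        "\<phi> (support_fun K x / m) + \<epsilon> * \<phi> (support_fun L x / m) = 1"
      using orlicz_norm[OF \<phi> e pos] .
    moreover have "h x = m" unfolding h_def using pos m by (intro orlicz_norm_Inf[OF \<phi> e pos]) auto
    ultimately show ?thesis by simp
  qed
  have hK: "support_fun K x \<le> h x" for x using h[of x] h0 support_fun_0[OF K] by (cases "x = 0") auto
  define M where "M = {y. \<forall>x. x \<bullet> y \<le> h x}"
  have KM: "K \<subseteq> M" using support_fun_ge[OF K'(1)] hK unfolding M_def by (blast intro: order_trans)
  have "M \<in> convex_bodies_o"
  proof -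
    have M: "M = (\<Inter>x. {y. x \<bullet> y \<le> h x})" by (auto simp: M_def)
    have "closed M" unfolding M by (intro closed_INT ballI closed_halfspace_le)
    moreover have "convex M" unfolding M by (intro convex_INT convex_halfspace_le)
    moreover have "bounded M"
    proof -
      obtain R where R: "K \<subseteq> cball 0 R" "0 < R" using compact_subset_cball[OF K'(1)] .
      obtain S where S: "L \<subseteq> cball 0 S" "0 < S" using compact_subset_cball[OF L'(1)] .
      have bd: "support_fun N x \<le> norm x * r" if "N \<subseteq> cball 0 r" "N \<noteq> {}" for N r and x :: "real ^ 'n"
      proof (rule support_fun_least[OF that(2)])
        fix y assume "y \<in> N"
        then have "norm y \<le> r" using that(1) by auto
        then show "x \<bullet> y \<le> norm x * r" by (meson norm_cauchy_schwarz mult_left_mono norm_ge_zero order_trans)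
      qed
      have "norm y \<le> R + S + \<epsilon> * S" if y: "y \<in> M" for y
      proof (cases "y = 0")
        case False
        have "norm y * norm y = y \<bullet> y" by (simp add: power2_norm_eq_inner flip: power2_eq_square)
        also have "\<dots> \<le> h y" using y by (simp add: M_def)
        also have "\<dots> \<le> support_fun K y + support_fun L y + \<epsilon> * support_fun L y" using h[OF False] by simp
        also have "\<dots> \<le> norm y * R + norm y * S + \<epsilon> * (norm y * S)"
          using e by (intro add_mono mult_left_mono bd R S K'(4) L'(4)) auto
        also have "\<dots> = norm y * (R + S + \<epsilon> * S)" by (simp add: algebra_simps)
        finally show ?thesis using False by (simp add: mult_le_cancel_left_pos)
      qed (use R S e in simp)
      then show ?thesis unfolding bounded_iff by blast
    qed
    moreover have "0 \<in> interior M" using K interior_mono[OF KM] by (auto simp: convex_bodies_o_def)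
    ultimately show ?thesis by (simp add: convex_bodies_o_def compact_eq_bounded_closed)
  qed
  moreover have "support_fun M x = h x" for x
  proof (cases "x = 0")
    case True
    then show ?thesis using h0 support_fun_0[OF \<open>M \<in> convex_bodies_o\<close>] by simp
  next
    case False
    have M': "compact M" "M \<noteq> {}" using convex_bodies_oD[OF \<open>M \<in> convex_bodies_o\<close>] by auto
    note pos = support_fun_pos[OF K False] support_fun_pos[OF L False]
    have hp: "0 < h y" if "y \<noteq> 0" for y using h[OF that] support_fun_pos[OF K that] by linarith
    define u v where "u = support_fun K x / h x" and "v = support_fun L x / h x"
    have uv: "0 < u" "0 < v" using pos hp[OF False] by (auto simp: u_def v_def)
    obtain s t where st: "0 \<le> s" "0 \<le> t" "\<phi> u \<le> s * u" "\<phi> v \<le> t * v"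
      "\<forall>x\<ge>0. \<forall>y\<ge>0. \<phi> u + \<epsilon> * \<phi> v + (s * x + \<epsilon> * t * y - (s * u + \<epsilon> * t * v)) \<le> \<phi> x + \<epsilon> * \<phi> y"
      using orlicz_tangent_line[OF \<phi> e uv] .
    define D where "D = s * u + \<epsilon> * t * v"
    have uv1: "\<phi> u + \<epsilon> * \<phi> v = 1" using h[OF False] by (simp add: u_def v_def)
    have "\<epsilon> * \<phi> v \<le> \<epsilon> * (t * v)" using st(4) e by (intro mult_left_mono) auto
    then have D: "1 \<le> D" using uv1 st(3) by (simp add: D_def mult.assoc)
    \<comment> \<open>The supporting line at \<open>(u, v)\<close> gives a Minkowski combination inside \<open>D M\<close>.\<close>
    have le: "s * support_fun K y + \<epsilon> * t * support_fun L y \<le> D * h y" for y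
    proof (cases "y = 0")
      case True then show ?thesis using h0 by (simp add: support_fun_0[OF K] support_fun_0[OF L])
    next
      case y: False
      have "s * support_fun K y + \<epsilon> * t * support_fun L y \<le> (D + 1 - 1) * h y"
        using st(5) uv1 support_fun_pos[OF K y] support_fun_pos[OF L y] hp[OF y] h[OF y]
        by (intro orlicz_tangent_bound[where \<phi> = \<phi>]) (auto simp: D_def)
      then show ?thesis by simp
    qed
    obtain k where k: "k \<in> K" "support_fun K x = x \<bullet> k" using support_fun_attained[OF K'(1,4)] .
    obtain l where l: "l \<in> L" "support_fun L x = x \<bullet> l" using support_fun_attained[OF L'(1,4)] .
    define z where "z = (1 / D) *\<^sub>R (s *\<^sub>R k + (\<epsilon> * t) *\<^sub>R l)"
    have "z \<in> M" unfolding M_def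
    proof (intro CollectI allI)
      fix y
      have "y \<bullet> z = (s * (y \<bullet> k) + \<epsilon> * t * (y \<bullet> l)) / D" by (simp add: z_def inner_add_right)
      also have "\<dots> \<le> (s * support_fun K y + \<epsilon> * t * support_fun L y) / D"
        using D st e support_fun_ge[OF K'(1) k(1), of y] support_fun_ge[OF L'(1) l(1), of y]
        by (intro divide_right_mono add_mono mult_left_mono) auto
      also have "\<dots> \<le> h y" using le[of y] D by (simp add: divide_le_eq mult.commute)
      finally show "y \<bullet> z \<le> h y" .
    qed
    then have "x \<bullet> z \<le> support_fun M x" by (rule support_fun_ge[OF M'(1)])
    moreover have "x \<bullet> z = h x"
    proof -
      have "x \<bullet> z = (s * support_fun K x + \<epsilon> * t * support_fun L x) / D" by (simp add: z_def inner_add_right k l)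
      also have "s * support_fun K x + \<epsilon> * t * support_fun L x = D * h x"
        using hp[OF False] by (simp add: D_def u_def v_def algebra_simps)
      finally show ?thesis using D by simp
    qed
    ultimately show ?thesis using support_fun_least[OF M'(2), of x "h x"] by (force simp: M_def)
  qed
  ultimately have ex: "M \<in> convex_bodies_o \<and> (\<forall>x. support_fun M x = h x)" by blast
  have "orlicz_comb \<phi> K \<epsilon> L = M"
    unfolding orlicz_comb_def h_def[symmetric]
  proof (rule the_equality)
    show "M \<in> convex_bodies_o \<and> (\<forall>x. support_fun M x = h x)" by (rule ex)
    show "N = M" if "N \<in> convex_bodies_o \<and> (\<forall>x. support_fun N x = h x)" for N
      using that ex by (intro body_eqI) auto
  qed
  then show ?thesis using ex by (simp add: h_def)
qed

section \<open>The inequality for Orlicz combinations\<close>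

lemma orlicz_comb_body:
  fixes K L :: "(real ^ 'n) set"
  assumes "\<phi> \<in> orlicz_class" "0 < \<epsilon>" "K \<in> convex_bodies_o" "L \<in> convex_bodies_o"
  shows "orlicz_comb \<phi> K \<epsilon> L \<in> convex_bodies_o"
  using orlicz_comb_ex[OF assms] by blast

lemma support_fun_orlicz_comb_eqI:
  fixes K L :: "(real ^ 'n) set"
  assumes as: "\<phi> \<in> orlicz_class" "0 < \<epsilon>" "K \<in> convex_bodies_o" "L \<in> convex_bodies_o" and x: "x \<noteq> 0"
    and m: "0 < m" "\<phi> (support_fun K x / m) + \<epsilon> * \<phi> (support_fun L x / m) = 1"
  shows "support_fun (orlicz_comb \<phi> K \<epsilon> L) x = m"
  using orlicz_comb_ex[OF as] orlicz_norm_Inf[OF as(1,2) support_fun_pos[OF as(3) x] support_fun_pos[OF as(4) x] m]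
  by simp

lemma support_fun_orlicz_comb:
  fixes K L :: "(real ^ 'n) set"
  assumes as: "\<phi> \<in> orlicz_class" "0 < \<epsilon>" "K \<in> convex_bodies_o" "L \<in> convex_bodies_o" and x: "x \<noteq> 0"
  defines "h \<equiv> support_fun (orlicz_comb \<phi> K \<epsilon> L) x"
  shows "\<phi> (support_fun K x / h) + \<epsilon> * \<phi> (support_fun L x / h) = 1"
proof -
  note pos = support_fun_pos[OF as(3) x] support_fun_pos[OF as(4) x]
  obtain m where m: "support_fun K x \<le> m" "\<phi> (support_fun K x / m) + \<epsilon> * \<phi> (support_fun L x / m) = 1"
    using orlicz_norm[OF as(1,2) pos] by blast
  then have "h = m" unfolding h_def using pos by (intro support_fun_orlicz_comb_eqI[OF as x]) auto
  then show ?thesis using m by simp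
qed

lemma strictly_convex_midpoint:
  assumes "strictly_convex_on S \<phi>" "a \<in> S" "b \<in> S" "a \<noteq> b"
  shows "\<phi> ((a + b) / 2) < (\<phi> a + \<phi> b) / 2"
  using assms(1)[unfolded strictly_convex_on_def, THEN conjunct2, rule_format, of a b "1 / 2"] assms(2-)
  by (simp add: field_simps)

lemma strictly_convex_orlicz_pos:
  assumes \<phi>: "\<phi> \<in> orlicz_class" and sc: "strictly_convex_on {0..} \<phi>" and u: "0 < u"
  shows "0 < \<phi> u"
  using strictly_convex_midpoint[OF sc, of 0 u] orlicz_classD(1)[OF \<phi>, of "u / 2"] orlicz_classD(4)[OF \<phi>] u
  by simp

context haar_grassmannian
begin

context
  fixes \<phi> :: "real \<Rightarrow> real" and \<epsilon> :: real and K L M :: "(real ^ 'n) set" and u v :: real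
  assumes \<phi>: "\<phi> \<in> orlicz_class" and e: "0 < \<epsilon>" and K: "K \<in> convex_bodies_o" and L: "L \<in> convex_bodies_o"
  defines "M \<equiv> orlicz_comb \<phi> K \<epsilon> L"
  defines "u \<equiv> quermass_radius K / quermass_radius M" and "v \<equiv> quermass_radius L / quermass_radius M"
begin

lemma M_body: "M \<in> convex_bodies_o"
  unfolding M_def by (rule orlicz_comb_body[OF \<phi> e K L])

lemma uv_pos: "0 < u" "0 < v"
  using quermass_radius_pos M_body K L by (auto simp: u_def v_def)

lemma tangent_support_bound:
  assumes tan: "\<forall>x\<ge>0. \<forall>y\<ge>0. g + (s * x + \<epsilon> * t * y - D) \<le> \<phi> x + \<epsilon> * \<phi> y"
  shows "s * support_fun K z + \<epsilon> * t * support_fun L z \<le> (D + 1 - g) * support_fun M z"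
proof (cases "z = 0")
  case True
  then show ?thesis by (simp add: support_fun_0[OF K] support_fun_0[OF L] support_fun_0[OF M_body])
next
  case z: False
  show ?thesis
    using support_fun_orlicz_comb[OF \<phi> e K L z, folded M_def]
    by (intro orlicz_tangent_bound[OF tan] support_fun_pos[OF K z] support_fun_pos[OF L z] support_fun_pos[OF M_body z])
qed

text \<open>A linear minorant of $\varphi(x) + \varepsilon\varphi(y)$ gives a Minkowski combination of $K$ and $L$ inside $M$.\<close>

lemma tangent_comb_subset:
  assumes tan: "\<forall>x\<ge>0. \<forall>y\<ge>0. g + (s * x + \<epsilon> * t * y - D) \<le> \<phi> x + \<epsilon> * \<phi> y"
    and st: "0 \<le> s" "0 \<le> t" and E: "0 < D + 1 - g" and kl: "k \<in> K" "l \<in> L"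
  shows "(s / (D + 1 - g)) *\<^sub>R k + (\<epsilon> * t / (D + 1 - g)) *\<^sub>R l \<in> M"
  unfolding mem_iff_support_fun[OF convex_bodies_oD(1,2,4)[OF M_body]]
proof
  fix z
  have "z \<bullet> ((s / (D + 1 - g)) *\<^sub>R k + (\<epsilon> * t / (D + 1 - g)) *\<^sub>R l) = (s * (z \<bullet> k) + \<epsilon> * t * (z \<bullet> l)) / (D + 1 - g)"
    by (simp add: inner_add_right add_divide_distrib)
  also have "\<dots> \<le> (s * support_fun K z + \<epsilon> * t * support_fun L z) / (D + 1 - g)"
    using st e E support_fun_ge[OF convex_bodies_oD(1)[OF K] kl(1), of z] support_fun_ge[OF convex_bodies_oD(1)[OF L] kl(2), of z]
    by (intro divide_right_mono add_mono mult_left_mono) auto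
  also have "\<dots> \<le> support_fun M z"
    using tangent_support_bound[OF tan, of z] E by (simp add: divide_le_eq mult.commute)
  finally show "z \<bullet> ((s / (D + 1 - g)) *\<^sub>R k + (\<epsilon> * t / (D + 1 - g)) *\<^sub>R l) \<le> support_fun M z" .
qed

text \<open>With the tangent line at $(u, v)$, the linear Brunn-Minkowski inequality reads $D \le D + 1 - g$.\<close>

lemma orlicz_quermass_ineq: "\<phi> u + \<epsilon> * \<phi> v \<le> 1"
proof -
  obtain s t where st: "0 \<le> s" "0 \<le> t" "\<phi> u \<le> s * u" "\<phi> v \<le> t * v"
    and tan: "\<forall>x\<ge>0. \<forall>y\<ge>0. \<phi> u + \<epsilon> * \<phi> v + (s * x + \<epsilon> * t * y - (s * u + \<epsilon> * t * v)) \<le> \<phi> x + \<epsilon> * \<phi> y"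
    using orlicz_tangent_line[OF \<phi> e uv_pos] .
  define D where "D = s * u + \<epsilon> * t * v"
  define g where "g = \<phi> u + \<epsilon> * \<phi> v"
  note tan' = tan[folded D_def g_def]
  have "\<epsilon> * \<phi> v \<le> \<epsilon> * (t * v)" using st(4) e by (intro mult_left_mono) auto
  then have E: "0 < D + 1 - g" using st(3) by (simp add: D_def g_def mult.assoc)
  have rM: "0 < quermass_radius M" by (rule quermass_radius_pos[OF M_body])
  have "s / (D + 1 - g) * quermass_radius K + \<epsilon> * t / (D + 1 - g) * quermass_radius L \<le> quermass_radius M"
    using st e E tangent_comb_subset[OF tan' st(1,2) E]
    by (intro quermass_radius_brunn_minkowski[OF K L M_body]) auto
  then have "(s * quermass_radius K + \<epsilon> * t * quermass_radius L) / (D + 1 - g) \<le> quermass_radius M"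
    by (simp add: add_divide_distrib)
  also have "s * quermass_radius K + \<epsilon> * t * quermass_radius L = D * quermass_radius M"
    using rM by (simp add: D_def u_def v_def algebra_simps)
  finally have "D * quermass_radius M \<le> (D + 1 - g) * quermass_radius M" using E by (simp add: divide_le_eq mult.commute)
  then have "D \<le> D + 1 - g" using rM by simp
  then show ?thesis by (simp add: g_def)
qed

text \<open>Equality makes the Minkowski combination from the tangent line fill up $M$; strict convexity then
  fixes the ratios of the support functions.\<close>

lemma orlicz_quermass_eq_imp_dilates:
  assumes sc: "strictly_convex_on {0..} \<phi>" and eq: "\<phi> u + \<epsilon> * \<phi> v = 1"
  shows "\<exists>c>0. L = (\<lambda>x. c *\<^sub>R x) ` K"
proof -
  obtain s t where st: "0 \<le> s" "0 \<le> t" "\<phi> u \<le> s * u" "\<phi> v \<le> t * v"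
    and tan: "\<forall>x\<ge>0. \<forall>y\<ge>0. \<phi> u + \<epsilon> * \<phi> v + (s * x + \<epsilon> * t * y - (s * u + \<epsilon> * t * v)) \<le> \<phi> x + \<epsilon> * \<phi> y"
    using orlicz_tangent_line[OF \<phi> e uv_pos] .
  define D where "D = s * u + \<epsilon> * t * v"
  note tan' = tan[folded D_def, unfolded eq]
  have "0 < s * u" "0 < t * v" using strictly_convex_orlicz_pos[OF \<phi> sc] uv_pos st by (metis less_le_trans)+
  then have st': "0 < s" "0 < t" using uv_pos by (simp_all add: zero_less_mult_iff)
  then have D: "0 < D" using uv_pos e by (simp add: D_def add_pos_pos)
  define N where "N = mink_comb (s / D) K (\<epsilon> * t / D) L"
  have ab: "0 < s / D" "0 < \<epsilon> * t / D" using st' D e by auto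
  have N: "N \<in> convex_bodies_o" unfolding N_def using ab by (intro mink_comb_body[OF K L])
  have NM: "N \<subseteq> M"
    using tangent_comb_subset[OF tan' st(1,2)] D by (auto simp: N_def mink_comb_def)
  have rM: "0 < quermass_radius M" by (rule quermass_radius_pos[OF M_body])
  have "quermass_radius M = s / D * quermass_radius K + \<epsilon> * t / D * quermass_radius L"
  proof -
    have "s / D * quermass_radius K + \<epsilon> * t / D * quermass_radius L = (s * quermass_radius K + \<epsilon> * t * quermass_radius L) / D"
      by (simp add: add_divide_distrib)
    also have "s * quermass_radius K + \<epsilon> * t * quermass_radius L = D * quermass_radius M"
      using rM by (simp add: D_def u_def v_def algebra_simps)
    finally show ?thesis using D by simp
  qed
  also have "\<dots> \<le> quermass_radius N"
    using ab by (intro quermass_radius_brunn_minkowski[OF K L N]) (auto simp: N_def mink_comb_def)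
  finally have "quermass_radius N = quermass_radius M"
    using quermass_radius_mono[OF N M_body NM] by simp
  then have "affine_quermassintegral \<nu> j N = affine_quermassintegral \<nu> j M"
    using quermass_radius_power N M_body by metis
  then have "N = M" by (rule quermassintegral_strict_mono[OF N M_body NM])
  have ratio: "support_fun K z = u * support_fun M z \<and> support_fun L z = v * support_fun M z" if z: "z \<noteq> 0" for z
  proof -
    note pos = support_fun_pos[OF K z] support_fun_pos[OF L z] support_fun_pos[OF M_body z]
    define x y where "x = support_fun K z / support_fun M z" and "y = support_fun L z / support_fun M z"
    have xy: "0 < x" "0 < y" using pos by (auto simp: x_def y_def)
    have one: "\<phi> x + \<epsilon> * \<phi> y = 1" unfolding x_def y_def M_def by (rule support_fun_orlicz_comb[OF \<phi> e K L z])
    have "support_fun M z = s / D * support_fun K z + \<epsilon> * t / D * support_fun L z"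
      using support_fun_mink_comb[OF K L ab] \<open>N = M\<close> by (simp add: N_def)
    also have "\<dots> = (s * x + \<epsilon> * t * y) / D * support_fun M z"
      using pos by (simp add: x_def y_def add_divide_distrib distrib_right)
    finally have "(s * x + \<epsilon> * t * y) / D = 1" using pos by (metis less_irrefl mult_cancel_right1)
    then have line: "s * x + \<epsilon> * t * y = D" using D by simp
    \<comment> \<open>\<open>(x, y)\<close> and \<open>(u, v)\<close> are on the tangent line and on the boundary curve,
      so strict convexity puts their midpoint strictly inside, against tangency.\<close>
    have mid: "1 \<le> \<phi> ((x + u) / 2) + \<epsilon> * \<phi> ((y + v) / 2)"
    proof -
      have "s * ((x + u) / 2) + \<epsilon> * t * ((y + v) / 2) = (s * x + \<epsilon> * t * y + D) / 2"
        by (simp add: D_def field_simps)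
      then have "s * ((x + u) / 2) + \<epsilon> * t * ((y + v) / 2) = D" using line by simp
      moreover have "0 \<le> (x + u) / 2" "0 \<le> (y + v) / 2" using xy uv_pos by auto
      ultimately show ?thesis using tan'[rule_format, of "(x + u) / 2" "(y + v) / 2"] by linarith
    qed
    have lt: "\<phi> ((a + b) / 2) < (\<phi> a + \<phi> b) / 2" if "0 < a" "0 < b" "a \<noteq> b" for a b
      using strictly_convex_midpoint[OF sc] that by simp
    then have le: "\<phi> ((a + b) / 2) \<le> (\<phi> a + \<phi> b) / 2" if "0 < a" "0 < b" for a b
      using that by (cases "a = b") (auto intro: less_imp_le)
    have sum: "(\<phi> x + \<phi> u) / 2 + \<epsilon> * ((\<phi> y + \<phi> v) / 2) = 1" using one eq by (simp add: field_simps)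
    have "x = u"
    proof (rule ccontr)
      assume "x \<noteq> u"
      then have "\<phi> ((x + u) / 2) + \<epsilon> * \<phi> ((y + v) / 2) < (\<phi> x + \<phi> u) / 2 + \<epsilon> * ((\<phi> y + \<phi> v) / 2)"
        using lt le xy uv_pos e by (intro add_less_le_mono mult_left_mono) auto
      then show False using mid sum by simp
    qed
    moreover have "y = v"
    proof (rule ccontr)
      assume "y \<noteq> v"
      then have "\<phi> ((x + u) / 2) + \<epsilon> * \<phi> ((y + v) / 2) < (\<phi> x + \<phi> u) / 2 + \<epsilon> * ((\<phi> y + \<phi> v) / 2)"
        using lt le xy uv_pos e by (intro add_le_less_mono mult_strict_left_mono) auto
      then show False using mid sum by simp
    qed
    ultimately show ?thesis using pos by (auto simp: x_def y_def)
  qed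
  have c: "0 < v / u" using uv_pos by simp
  have "L = (\<lambda>x. (v / u) *\<^sub>R x) ` K"
  proof (rule body_eqI[OF L dilate_body[OF K c]])
    fix z :: "real ^ 'n" assume "z \<noteq> 0"
    then show "support_fun L z = support_fun ((\<lambda>x. (v / u) *\<^sub>R x) ` K) z"
      using ratio uv_pos by (simp add: support_fun_dilate[OF K c])
  qed
  then show ?thesis using c by blast
qed

text \<open>For $L = cK$ the combination is $mK$, where $m$ solves the defining equation with $1$ and $c$ in place of the
  support functions.\<close>

lemma dilates_imp_orlicz_quermass_eq:
  assumes c: "0 < c" and Lc: "L = (\<lambda>x. c *\<^sub>R x) ` K"
  shows "\<phi> u + \<epsilon> * \<phi> v = 1"
proof -
  obtain m where m: "1 \<le> m" "\<phi> (1 / m) + \<epsilon> * \<phi> (c / m) = 1"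
    using orlicz_norm[OF \<phi> e zero_less_one c] by blast
  then have m0: "0 < m" by simp
  have "M = (\<lambda>x. m *\<^sub>R x) ` K"
  proof (rule body_eqI[OF M_body dilate_body[OF K m0]])
    fix z :: "real ^ 'n" assume z: "z \<noteq> 0"
    have "support_fun M z = m * support_fun K z"
      unfolding M_def
      by (rule support_fun_orlicz_comb_eqI[OF \<phi> e K L z])
        (use m m0 support_fun_pos[OF K z] in \<open>auto simp: Lc support_fun_dilate[OF K c]\<close>)
    then show "support_fun M z = support_fun ((\<lambda>x. m *\<^sub>R x) ` K) z"
      by (simp add: support_fun_dilate[OF K m0])
  qed
  then have "u = 1 / m" "v = c / m"
    using quermass_radius_dilate[OF K m0] quermass_radius_dilate[OF K c] quermass_radius_pos[OF K]
    by (auto simp: u_def v_def Lc)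
  then show ?thesis using m by simp
qed

end

end

theorem theorem4p2:
  fixes K L :: "(real ^ 'n) set" and \<phi> :: "real \<Rightarrow> real" and \<epsilon> :: real and j :: nat
    and \<nu> :: "(real ^ 'n) set measure"
  assumes "K \<in> convex_bodies_o" and "L \<in> convex_bodies_o"
    and "1 \<le> j" and "j \<le> CARD('n)"
    and "\<phi> \<in> orlicz_class" and "\<epsilon> > 0"
    and "grassmannian_haar j \<nu>"
  defines "\<Phi> \<equiv> affine_quermassintegral \<nu> j"
    and "M \<equiv> orlicz_comb \<phi> K \<epsilon> L"
  shows "1 \<ge> \<phi> ((\<Phi> K / \<Phi> M) powr (1 / real j)) + \<epsilon> * \<phi> ((\<Phi> L / \<Phi> M) powr (1 / real j)) \<and>
    (strictly_convex_on {0..} \<phi> \<longrightarrow>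
      (1 = \<phi> ((\<Phi> K / \<Phi> M) powr (1 / real j)) + \<epsilon> * \<phi> ((\<Phi> L / \<Phi> M) powr (1 / real j)) \<longleftrightarrow>
       (\<exists>c>0. L = (\<lambda>x. c *\<^sub>R x) ` K)))"
proof -
  interpret haar_grassmannian j \<nu> by unfold_locales fact+
  have M: "M \<in> convex_bodies_o" unfolding M_def by (rule orlicz_comb_body) fact+
  have r: "(\<Phi> X / \<Phi> M) powr (1 / real j) = quermass_radius X / quermass_radius M" if "X \<in> convex_bodies_o" for X
    using quermassintegral_pos[OF that] quermassintegral_pos[OF M]
    by (simp add: \<Phi>_def quermass_radius_def powr_divide)
  note prems = assms(5,6,1,2)
  show ?thesis
    unfolding r[OF assms(1)] r[OF assms(2)] unfolding M_def
    using orlicz_quermass_ineq[OF prems] orlicz_quermass_eq_imp_dilates[OF prems]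
      dilates_imp_orlicz_quermass_eq[OF prems]
    by metis
qed

end
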